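(* Let $U$ be a utility function whose concave envelope $U^{**}$ is a PSAHARA utility function, with partition $-\infty=a_0<a_1<\dots<a_n<a_{n+1}=\infty$ and parameters $(\alpha_k,\beta_k,d_k,\gamma_k,u_k)_{k=0}^n$, $\alpha_k\in[0,\infty)$ for each $k$ (with $\alpha_0,\alpha_n\neq0$ so that $1/\alpha_0,1/\alpha_n$ make sense). Fix $t\in[0,T)$ and $y^*\in(0,\infty)$, and regard the quantities $X_t^*,X_t^D,X_t^B,X_t^R,X_t^{\bar R},\pmb\pi_t^*,\pmb\pi_t^{(2)},\pmb\pi_t^{(3)},\pmb\pi_t^{(4)}$ defined in the context as functions of $\xi_t\in(0,\infty)$. (a) As $\xi_t\to0$, $$X_t^*\to\infty,\qquad\frac{\pmb\pi_t^*}{X_t^*}\to\frac1{\alpha_n}(\pmb\sigma_t\pmb\sigma_t^\intercal)^{-1}(\pmb\mu_t-r_t\mathbf 1_m);$$ moreover $X_t^R\to\infty$, $X_t^{\bar R}\to0$, $X_t^B\to d_ne^{-\int_t^Tr_sds}$, $X_t^D\to0$, every component of $\pmb\pi_t^*$ tends to $\infty$, and $\pmb\pi_t^{(2)},\pmb\pi_t^{(3)},\pmb\pi_t^{(4)}\to\mathbf 0$. (b) As $\xi_t\to\infty$, $$X_t^*\to-\infty,\qquad\frac{\pmb\pi_t^*}{X_t^*}\to-\frac1{\alpha_0}(\pmb\sigma_t\pmb\sigma_t^\intercal)^{-1}(\pmb\mu_t-r_t\mathbf 1_m);$$ moreover $X_t^R\to0$, $X_t^{\bar R}\to-\infty$,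 $X_t^B\to d_0e^{-\int_t^Tr_sds}$, $X_t^D\to0$, every component of $\pmb\pi_t^*$ tends to $\infty$, and $\pmb\pi_t^{(2)},\pmb\pi_t^{(3)},\pmb\pi_t^{(4)}\to\mathbf 0$.
   Context: **Market coefficients.** Fix $T>0$ and integers $1\le m\le q$. All market parameters are deterministic processes on $[0,T]$: the risk-free rate $r_t\in\mathbb R$, the return vector $\pmb\mu_t\in\mathbb R^m$ with $\mu_{i,t}>r_t$ for all $i,t$, and the volatility matrix $\pmb\sigma_t\in\mathbb R^{m\times q}$ with $\pmb\sigma_t\pmb\sigma_t^\intercal$ positive definite for all $t$. Let $\mathbf 1_m=(1,\dots,1)^\intercal$ and $\pmb\theta_t=\pmb\sigma_t^\intercal(\pmb\sigma_t\pmb\sigma_t^\intercal)^{-1}(\pmb\mu_t-r_t\mathbf 1_m)$. Standing assumption: $\sup_t\|\pmb\mu_t\|_2<\infty$, $\sup_tr_t<\infty$, $\sup_t\|\tilde{\pmb\theta}_t\|_2<\infty$ for the market prices of risk (deterministic solutions $\tilde{\pmb\theta}$ of $\pmb\sigma_t\tilde{\pmb\theta}_t=\pmb\mu_t-r_t\mathbf 1_m$), $\exp\{\frac12\int_0^T\|\pmb\theta_t\|_2^2dt\}<\infty$, and $\sup_t\lambda_t^{\max}<\infty$ where $\lambda_t^{\max}$ is the largest eigenvalue of $\pmb\sigma_t\pmb\sigma_t^\intercal$. In the market model $\xi_t=\exp\{-\int_0^t(r_s+\frac12\|\pmb\theta_s\|_2^2)ds-\int_0^t\pmb\theta_s^\intercal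 d\mathbf W_s\}$ for a $q$-dimensional Brownian motion $\mathbf W$; $X_t^*$ and $\pmb\pi_t^*$ below are the optimal wealth and optimal portfolio (amounts in the $m$ risky assets) for maximizing $\mathbb E[U(X_T)]$, where wealth satisfies $dX_t=(r_tX_t+\pmb\pi_t^\intercal(\pmb\mu_t-r_t\mathbf 1_m))dt+\pmb\pi_t^\intercal\pmb\sigma_td\mathbf W_t$. The claim concerns only the explicit formulas below. **PSAHARA utilities.** For $\alpha\ge0$, $\beta>0$, $d\in\mathbb R$, let $$\hat U(x;\alpha,\beta,d)=-\frac1{\alpha^2-1}\left((x-d)+\sqrt{\beta^2+(x-d)^2}\right)^{-\alpha}\left((x-d)+\alpha\sqrt{\beta^2+(x-d)^2}\right)\quad(\alpha\ne1),$$ $$\hat U(x;1,\beta,d)=\tfrac12\log\left((x-d)+\sqrt{\beta^2+(x-d)^2}\right)+\tfrac12\beta^{-2}(x-d)\left(\sqrt{\beta^2+(x-d)^2}-(x-d)\right).$$ A function $V:\mathbb R\to\mathbb R$ is a PSAHARA utility function if there are $n\ge0$, a partition $-\infty=a_0<a_1<\dots<a_n<a_{n+1}=\infty$ and parameters $\alpha_k\ge0,\beta_k>0,d_k\in\mathbb R,\gamma_k>0,u_k\in\mathbb R$ ($k=0,\dots,n$) such that $V$ is increasing and continuous and $V(x)=\gamma_k\hat U(x;\alpha_k,\beta_k,d_k)+u_k$ for $x\in(a_k,a_{k+1})$. The concave envelope $U^{**}$ is the smallest continuous concave function $\ge U$. **Notation.** $\gamma_k^\pm=(U^{**})'(a_k^\pm)$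 (one-sided derivatives), $\gamma_0^+=\infty$, $\gamma_{n+1}^-=0$. $\Phi$ is the standard normal distribution function. For $z>0$, $$g_0(z)=-\frac{1}{\sqrt{\int_t^T\|\pmb\theta_s\|_2^2ds}}\left(\log z+\int_t^T\left(r_s-\tfrac12\|\pmb\theta_s\|_2^2\right)ds\right),$$ $$g_{1,k}(z)=g_0(z)-\frac1{\alpha_k}\sqrt{\int_t^T\|\pmb\theta_s\|_2^2ds},\qquad g_{2,k}(z)=g_0(z)+\frac1{\alpha_k}\sqrt{\int_t^T\|\pmb\theta_s\|_2^2ds},$$ with $g(\infty)=-\infty$, $g(0)=\infty$ for each of these functions. Write, for $g\in\{g_0,g_{1,k},g_{2,k}\}$, $\Delta_k\Phi(g)=\Phi(g(\frac{\gamma_{k+1}^-}{y^*\xi_t}))-\Phi(g(\frac{\gamma_k^+}{y^*\xi_t}))$ and $\Delta_k\Phi'(g)$ likewise with $\Phi'$. Define (terms with $\mathbf 1_{\{\alpha_k\ne0\}}$ vanish if $\alpha_k=0$) $$X_t^D=\sum_{k=1}^ne^{-\int_t^Tr_sds}a_k\left[\Phi\left(g_0\left(\tfrac{\gamma_k^+}{y^*\xi_t}\right)\right)-\Phi\left(g_0\left(\tfrac{\gamma_k^-}{y^*\xi_t}\right)\right)\right],\qquad X_t^B=\sum_{k=0}^ne^{-\int_t^Tr_sds}d_k\,\Delta_k\Phi(g_0)\,\mathbf 1_{\{\alpha_k\ne0\}},$$ $$X_{t,k}^R=e^{(-1+\frac1{\alpha_k})\int_t^T(r_s+\frac1{2\alpha_k}\|\pmb\theta_s\|_2^2)ds}\tfrac12\left(\tfrac{\gamma_k}{y^*\xi_t}\right)^{\frac1{\alpha_k}}\Delta_k\Phi(g_{1,k})\mathbf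 1_{\{\alpha_k\ne0\}},$$ $$X_{t,k}^{\bar R}=-\tfrac12\beta_k^2e^{(-1-\frac1{\alpha_k})\int_t^T(r_s-\frac1{2\alpha_k}\|\pmb\theta_s\|_2^2)ds}\left(\tfrac{\gamma_k}{y^*\xi_t}\right)^{-\frac1{\alpha_k}}\Delta_k\Phi(g_{2,k})\mathbf 1_{\{\alpha_k\ne0\}},$$ $X_t^R=\sum_{k=0}^nX_{t,k}^R$, $X_t^{\bar R}=\sum_{k=0}^nX_{t,k}^{\bar R}$, $X_t^*=X_t^D+X_t^B+X_t^R+X_t^{\bar R}$. With $\pmb\eta_t=(\pmb\sigma_t\pmb\sigma_t^\intercal)^{-1}(\pmb\mu_t-r_t\mathbf 1_m)$, $\Sigma_t=\sqrt{\int_t^T\|\pmb\theta_s\|_2^2ds}$ and $b_{t,k}=\beta_k^2e^{2\int_t^T(-r_s+\frac1{2\alpha_k^2}\|\pmb\theta_s\|_2^2)ds}\Delta_k\Phi(g_{1,k})\Delta_k\Phi(g_{2,k})$, define $$\pmb\pi_t^{(1)}=\pmb\eta_t\sum_{k=0}^n\tfrac1{\alpha_k}\sqrt{(X_{t,k}^R+X_{t,k}^{\bar R})^2+b_{t,k}}\,\mathbf 1_{\{\alpha_k\ne0\}},$$ $$\pmb\pi_t^{(2)}=-\frac{\pmb\eta_t}{\Sigma_t}\sum_{k=0}^n\left\{X_{t,k}^R\frac{\Delta_k\Phi'(g_{1,k})}{\Delta_k\Phi(g_{1,k})}+X_{t,k}^{\bar R}\frac{\Delta_k\Phi'(g_{2,k})}{\Delta_k\Phi(g_{2,k})}\right\}\mathbf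 1_{\{\alpha_k\ne0\}},$$ $$\pmb\pi_t^{(3)}=-\frac{\pmb\eta_t}{\Sigma_t}e^{-\int_t^Tr_sds}\sum_{k=1}^na_k\left[\Phi'\left(g_0\left(\tfrac{\gamma_k^+}{y^*\xi_t}\right)\right)-\Phi'\left(g_0\left(\tfrac{\gamma_k^-}{y^*\xi_t}\right)\right)\right],\qquad\pmb\pi_t^{(4)}=-\frac{\pmb\eta_t}{\Sigma_t}e^{-\int_t^Tr_sds}\sum_{k=0}^nd_k\,\Delta_k\Phi'(g_0),$$ and $\pmb\pi_t^*=\pmb\pi_t^{(1)}+\pmb\pi_t^{(2)}+\pmb\pi_t^{(3)}+\pmb\pi_t^{(4)}$.
   Formalization: "Every component of π* tends to ∞" is claimed only for components i where the i-th entry of (σσᵀ)^{-1}(μ−r1) is positive; otherwise it is false, e.g. r=0, μ=(1,0.1), σσᵀ=[[1,0.9],[0.9,1]], where the second component tends to −∞. *)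

theory Defs
  imports "HOL-Probability.Probability"
begin

section \<open>Market coefficients\<close>

text \<open>
  The number of risky assets is \<open>CARD('m)\<close>, the dimension of the Brownian motion is \<open>CARD('q)\<close>.
  Only the values of the coefficients on \<open>{0..horizon M}\<close> matter.
\<close>

record ('m, 'q) market =
  horizon :: real
  rate :: "real \<Rightarrow> real"
  returns :: "real \<Rightarrow> real ^ 'm"
  vol :: "real \<Rightarrow> real ^ 'q ^ 'm"

definition excess :: "('m::finite, 'q::finite) market \<Rightarrow> real \<Rightarrow> real ^ 'm" where
  "excess M s = returns M s - rate M s *\<^sub>R 1"

definition cov :: "('m::finite, 'q::finite) market \<Rightarrow> real \<Rightarrow> real ^ 'm ^ 'm" where
  "cov M s = vol M s ** transpose (vol M s)"

definition eta :: "('m::finite, 'q::finite) market \<Rightarrow> real \<Rightarrow> real ^ 'm" where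
  "eta M s = matrix_inv (cov M s) *v excess M s"

definition theta :: "('m::finite, 'q::finite) market \<Rightarrow> real \<Rightarrow> real ^ 'q" where
  "theta M s = transpose (vol M s) *v (matrix_inv (cov M s) *v excess M s)"

definition positive_definite :: "real ^ 'n ^ 'n \<Rightarrow> bool" where
  "positive_definite A \<longleftrightarrow> transpose A = A \<and> (\<forall>x. x \<noteq> 0 \<longrightarrow> 0 < x \<bullet> (A *v x))"

definition largest_eigenvalue :: "real ^ 'n ^ 'n \<Rightarrow> real" where
  "largest_eigenvalue A = Max {c. \<exists>v. v \<noteq> 0 \<and> A *v v = c *\<^sub>R v}"

definition market_price_of_risk ::
    "('m::finite, 'q::finite) market \<Rightarrow> (real \<Rightarrow> real ^ 'q) \<Rightarrow> bool" where
  "market_price_of_risk M th \<longleftrightarrow> (\<forall>s\<in>{0..horizon M}. vol M s *v th s = excess M s)"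

text \<open>
  If \<open>CARD('m) < CARD('q)\<close>, the equation for the market price of risk has unbounded solutions, so
  the boundedness assumption can only concern the market price of risk that is considered; it is
  required here of some market price of risk (equivalently, of the minimal-norm one, \<open>theta M\<close>).
  Integrability of the squared norm of \<open>theta M\<close> says that
  \<open>exp (1/2 * \<integral>\<^sub>0\<^sup>T (norm (theta M s))\<^sup>2 ds)\<close> is finite.
\<close>

definition admissible_market :: "('m::finite, 'q::finite) market \<Rightarrow> bool" where
  "admissible_market M \<longleftrightarrow>
     0 < horizon M \<and> CARD('m) \<le> CARD('q) \<and>
     rate M \<in> borel_measurable (restrict_space borel {0..horizon M}) \<and>
     returns M \<in> borel_measurable (restrict_space borel {0..horizon M}) \<and>
     vol M \<in> borel_measurable (restrict_space borel {0..horizon M}) \<and>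
     (\<forall>s\<in>{0..horizon M}. \<forall>i. rate M s < returns M s $ i) \<and>
     (\<forall>s\<in>{0..horizon M}. positive_definite (cov M s)) \<and>
     bounded (returns M ` {0..horizon M}) \<and>
     bdd_above (rate M ` {0..horizon M}) \<and>
     (\<exists>th. market_price_of_risk M th \<and> bounded (th ` {0..horizon M})) \<and>
     set_integrable lborel {0..horizon M} (\<lambda>s. (norm (theta M s))\<^sup>2) \<and>
     bdd_above ((\<lambda>s. largest_eigenvalue (cov M s)) ` {0..horizon M})"

section \<open>PSAHARA utilities and concave envelopes\<close>

definition sahara :: "real \<Rightarrow> real \<Rightarrow> real \<Rightarrow> real \<Rightarrow> real" where
  "sahara \<alpha> \<beta> d x =
     (let y = x - d; w = sqrt (\<beta>\<^sup>2 + (x - d)\<^sup>2) in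
      if \<alpha> = 1 then ln (y + w) / 2 + y * (w - y) / (2 * \<beta>\<^sup>2)
      else - (1 / (\<alpha>\<^sup>2 - 1)) * (y + w) powr (- \<alpha>) * (y + \<alpha> * w))"

text \<open>
  \<open>pieces P\<close> is \<open>n\<close>; the partition points \<open>a\<^sub>k\<close> are \<open>node P k\<close> for \<open>k \<le> n + 1\<close>, and the parameters
  \<open>\<alpha>\<^sub>k, \<beta>\<^sub>k, d\<^sub>k, \<gamma>\<^sub>k, u\<^sub>k\<close> are \<open>alpha, beta, shift, scale, offset\<close> for \<open>k \<le> n\<close>.
\<close>

record psahara =
  pieces :: nat
  node :: "nat \<Rightarrow> ereal"
  alpha :: "nat \<Rightarrow> real"
  beta :: "nat \<Rightarrow> real"
  shift :: "nat \<Rightarrow> real"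
  scale :: "nat \<Rightarrow> real"
  offset :: "nat \<Rightarrow> real"

definition is_psahara :: "psahara \<Rightarrow> (real \<Rightarrow> real) \<Rightarrow> bool" where
  "is_psahara P V \<longleftrightarrow>
     node P 0 = -\<infinity> \<and> node P (Suc (pieces P)) = \<infinity> \<and>
     (\<forall>k\<le>pieces P. node P k < node P (Suc k)) \<and>
     (\<forall>k\<le>pieces P. 0 \<le> alpha P k \<and> 0 < beta P k \<and> 0 < scale P k) \<and>
     mono V \<and> continuous_on UNIV V \<and>
     (\<forall>k\<le>pieces P. \<forall>x. node P k < ereal x \<and> ereal x < node P (Suc k) \<longrightarrow>
        V x = scale P k * sahara (alpha P k) (beta P k) (shift P k) x + offset P k)"

definition is_concave_envelope :: "(real \<Rightarrow> real) \<Rightarrow> (real \<Rightarrow> real) \<Rightarrow> bool" where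
  "is_concave_envelope U V \<longleftrightarrow>
     continuous_on UNIV V \<and> concave_on UNIV V \<and> (\<forall>x. U x \<le> V x) \<and>
     (\<forall>W. continuous_on UNIV W \<and> concave_on UNIV W \<and> (\<forall>x. U x \<le> W x) \<longrightarrow> (\<forall>x. V x \<le> W x))"

text \<open>The one-sided derivatives \<open>\<gamma>\<^sub>k\<^sup>-\<close> and \<open>\<gamma>\<^sub>k\<^sup>+\<close>, with \<open>\<gamma>\<^sub>0\<^sup>+ = \<infinity>\<close> and \<open>\<gamma>\<^sub>n\<^sub>+\<^sub>1\<^sup>- = 0\<close>.\<close>

definition slope_right :: "psahara \<Rightarrow> (real \<Rightarrow> real) \<Rightarrow> nat \<Rightarrow> ereal" where
  "slope_right P V k =
     (if k = 0 then \<infinity> else ereal (vector_derivative V (at_right (real_of_ereal (node P k)))))"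

definition slope_left :: "psahara \<Rightarrow> (real \<Rightarrow> real) \<Rightarrow> nat \<Rightarrow> ereal" where
  "slope_left P V k =
     (if k = Suc (pieces P) then 0
      else ereal (vector_derivative V (at_left (real_of_ereal (node P k)))))"

section \<open>Optimal wealth and portfolio\<close>

text \<open>The normal distribution function and its derivative, extended to \<open>\<plusminus>\<infinity>\<close> by their limits.\<close>

definition \<Phi> :: "ereal \<Rightarrow> real" where
  "\<Phi> z = (case z of ereal x \<Rightarrow> cdf std_normal_distribution x | PInfty \<Rightarrow> 1 | MInfty \<Rightarrow> 0)"

definition \<Phi>' :: "ereal \<Rightarrow> real" where
  "\<Phi>' z = (case z of ereal x \<Rightarrow> deriv (cdf std_normal_distribution) x | PInfty \<Rightarrow> 0 | MInfty \<Rightarrow> 0)"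

definition Sig :: "('m::finite, 'q::finite) market \<Rightarrow> real \<Rightarrow> real" where
  "Sig M t = sqrt (LBINT s:{t..horizon M}. (norm (theta M s))\<^sup>2)"

definition discount :: "('m::finite, 'q::finite) market \<Rightarrow> real \<Rightarrow> real" where
  "discount M t = exp (- (LBINT s:{t..horizon M}. rate M s))"

definition g0 :: "('m::finite, 'q::finite) market \<Rightarrow> real \<Rightarrow> ereal \<Rightarrow> ereal" where
  "g0 M t z =
     (if z = \<infinity> then -\<infinity>
      else if z \<le> 0 then \<infinity>
      else ereal (- (1 / Sig M t) *
        (ln (real_of_ereal z)
          + (LBINT s:{t..horizon M}. rate M s - (norm (theta M s))\<^sup>2 / 2))))"

definition g1 ::
    "('m::finite, 'q::finite) market \<Rightarrow> psahara \<Rightarrow> real \<Rightarrow> nat \<Rightarrow> ereal \<Rightarrow> ereal" where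
  "g1 M P t k z = g0 M t z - ereal (1 / alpha P k * Sig M t)"

definition g2 ::
    "('m::finite, 'q::finite) market \<Rightarrow> psahara \<Rightarrow> real \<Rightarrow> nat \<Rightarrow> ereal \<Rightarrow> ereal" where
  "g2 M P t k z = g0 M t z + ereal (1 / alpha P k * Sig M t)"

text \<open>
  \<open>Delta P V y \<xi> k F\<close> is \<open>\<Delta>\<^sub>k F\<close>, where \<open>F\<close> is a composition such as \<open>\<Phi> \<circ> g0 M t\<close>.
\<close>

definition Delta ::
    "psahara \<Rightarrow> (real \<Rightarrow> real) \<Rightarrow> real \<Rightarrow> real \<Rightarrow> nat \<Rightarrow> (ereal \<Rightarrow> real) \<Rightarrow> real" where
  "Delta P V y \<xi> k F =
     F (slope_left P V (Suc k) / ereal (y * \<xi>)) - F (slope_right P V k / ereal (y * \<xi>))"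

text \<open>
  In all formulas below \<open>P\<close> and \<open>V\<close> describe the PSAHARA function \<open>U\<^sup>*\<^sup>*\<close>, \<open>y\<close> is the multiplier \<open>y\<^sup>*\<close>
  and \<open>\<xi>\<close> is the value of the pricing kernel at time \<open>t\<close>. For \<open>\<alpha>\<^sub>k = 0\<close> the totalised value of
  \<open>1 / alpha P k\<close> is irrelevant because the summand is multiplied by zero.
\<close>

definition X_D ::
    "('m::finite, 'q::finite) market \<Rightarrow> psahara \<Rightarrow> (real \<Rightarrow> real) \<Rightarrow> real \<Rightarrow> real \<Rightarrow> real \<Rightarrow> real" where
  "X_D M P V y t \<xi> =
     (\<Sum>k=1..pieces P. discount M t * real_of_ereal (node P k) *
        (\<Phi> (g0 M t (slope_right P V k / ereal (y * \<xi>)))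
         - \<Phi> (g0 M t (slope_left P V k / ereal (y * \<xi>)))))"

definition X_B ::
    "('m::finite, 'q::finite) market \<Rightarrow> psahara \<Rightarrow> (real \<Rightarrow> real) \<Rightarrow> real \<Rightarrow> real \<Rightarrow> real \<Rightarrow> real" where
  "X_B M P V y t \<xi> =
     (\<Sum>k=0..pieces P. discount M t * shift P k * Delta P V y \<xi> k (\<Phi> \<circ> g0 M t)
        * of_bool (alpha P k \<noteq> 0))"

definition X_Rk ::
    "('m::finite, 'q::finite) market \<Rightarrow> psahara \<Rightarrow> (real \<Rightarrow> real) \<Rightarrow> real \<Rightarrow> real \<Rightarrow> nat \<Rightarrow> real \<Rightarrow> real"
  where
  "X_Rk M P V y t k \<xi> =
     exp ((- 1 + 1 / alpha P k) *
          (LBINT s:{t..horizon M}. rate M s + 1 / (2 * alpha P k) * (norm (theta M s))\<^sup>2))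
     * (1 / 2) * (scale P k / (y * \<xi>)) powr (1 / alpha P k)
     * Delta P V y \<xi> k (\<Phi> \<circ> g1 M P t k) * of_bool (alpha P k \<noteq> 0)"

definition X_Rbark ::
    "('m::finite, 'q::finite) market \<Rightarrow> psahara \<Rightarrow> (real \<Rightarrow> real) \<Rightarrow> real \<Rightarrow> real \<Rightarrow> nat \<Rightarrow> real \<Rightarrow> real"
  where
  "X_Rbark M P V y t k \<xi> =
     - (1 / 2) * (beta P k)\<^sup>2
     * exp ((- 1 - 1 / alpha P k) *
            (LBINT s:{t..horizon M}. rate M s - 1 / (2 * alpha P k) * (norm (theta M s))\<^sup>2))
     * (scale P k / (y * \<xi>)) powr (- (1 / alpha P k))
     * Delta P V y \<xi> k (\<Phi> \<circ> g2 M P t k) * of_bool (alpha P k \<noteq> 0)"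

definition X_R ::
    "('m::finite, 'q::finite) market \<Rightarrow> psahara \<Rightarrow> (real \<Rightarrow> real) \<Rightarrow> real \<Rightarrow> real \<Rightarrow> real \<Rightarrow> real" where
  "X_R M P V y t \<xi> = (\<Sum>k=0..pieces P. X_Rk M P V y t k \<xi>)"

definition X_Rbar ::
    "('m::finite, 'q::finite) market \<Rightarrow> psahara \<Rightarrow> (real \<Rightarrow> real) \<Rightarrow> real \<Rightarrow> real \<Rightarrow> real \<Rightarrow> real" where
  "X_Rbar M P V y t \<xi> = (\<Sum>k=0..pieces P. X_Rbark M P V y t k \<xi>)"

definition X_opt ::
    "('m::finite, 'q::finite) market \<Rightarrow> psahara \<Rightarrow> (real \<Rightarrow> real) \<Rightarrow> real \<Rightarrow> real \<Rightarrow> real \<Rightarrow> real" where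
  "X_opt M P V y t \<xi> = X_D M P V y t \<xi> + X_B M P V y t \<xi> + X_R M P V y t \<xi> + X_Rbar M P V y t \<xi>"

definition b_term ::
    "('m::finite, 'q::finite) market \<Rightarrow> psahara \<Rightarrow> (real \<Rightarrow> real) \<Rightarrow> real \<Rightarrow> real \<Rightarrow> nat \<Rightarrow> real \<Rightarrow> real"
  where
  "b_term M P V y t k \<xi> =
     (beta P k)\<^sup>2
     * exp (2 * (LBINT s:{t..horizon M}.
                   - rate M s + 1 / (2 * (alpha P k)\<^sup>2) * (norm (theta M s))\<^sup>2))
     * Delta P V y \<xi> k (\<Phi> \<circ> g1 M P t k) * Delta P V y \<xi> k (\<Phi> \<circ> g2 M P t k)"

definition pi_1 ::
    "('m::finite, 'q::finite) market \<Rightarrow> psahara \<Rightarrow> (real \<Rightarrow> real) \<Rightarrow> real \<Rightarrow> real \<Rightarrow> real \<Rightarrow> real ^ 'm"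
  where
  "pi_1 M P V y t \<xi> =
     (\<Sum>k=0..pieces P. 1 / alpha P k
        * sqrt ((X_Rk M P V y t k \<xi> + X_Rbark M P V y t k \<xi>)\<^sup>2 + b_term M P V y t k \<xi>)
        * of_bool (alpha P k \<noteq> 0)) *\<^sub>R eta M t"

definition pi_2 ::
    "('m::finite, 'q::finite) market \<Rightarrow> psahara \<Rightarrow> (real \<Rightarrow> real) \<Rightarrow> real \<Rightarrow> real \<Rightarrow> real \<Rightarrow> real ^ 'm"
  where
  "pi_2 M P V y t \<xi> =
     (- (1 / Sig M t) *
      (\<Sum>k=0..pieces P.
        (X_Rk M P V y t k \<xi>
           * (Delta P V y \<xi> k (\<Phi>' \<circ> g1 M P t k) / Delta P V y \<xi> k (\<Phi> \<circ> g1 M P t k))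
         + X_Rbark M P V y t k \<xi>
           * (Delta P V y \<xi> k (\<Phi>' \<circ> g2 M P t k) / Delta P V y \<xi> k (\<Phi> \<circ> g2 M P t k)))
        * of_bool (alpha P k \<noteq> 0))) *\<^sub>R eta M t"

definition pi_3 ::
    "('m::finite, 'q::finite) market \<Rightarrow> psahara \<Rightarrow> (real \<Rightarrow> real) \<Rightarrow> real \<Rightarrow> real \<Rightarrow> real \<Rightarrow> real ^ 'm"
  where
  "pi_3 M P V y t \<xi> =
     (- (1 / Sig M t) * discount M t *
      (\<Sum>k=1..pieces P. real_of_ereal (node P k) *
         (\<Phi>' (g0 M t (slope_right P V k / ereal (y * \<xi>)))
          - \<Phi>' (g0 M t (slope_left P V k / ereal (y * \<xi>)))))) *\<^sub>R eta M t"

definition pi_4 ::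
    "('m::finite, 'q::finite) market \<Rightarrow> psahara \<Rightarrow> (real \<Rightarrow> real) \<Rightarrow> real \<Rightarrow> real \<Rightarrow> real \<Rightarrow> real ^ 'm"
  where
  "pi_4 M P V y t \<xi> =
     (- (1 / Sig M t) * discount M t *
      (\<Sum>k=0..pieces P. shift P k * Delta P V y \<xi> k (\<Phi>' \<circ> g0 M t))) *\<^sub>R eta M t"

definition pi_opt ::
    "('m::finite, 'q::finite) market \<Rightarrow> psahara \<Rightarrow> (real \<Rightarrow> real) \<Rightarrow> real \<Rightarrow> real \<Rightarrow> real \<Rightarrow> real ^ 'm"
  where
  "pi_opt M P V y t \<xi> = pi_1 M P V y t \<xi> + pi_2 M P V y t \<xi> + pi_3 M P V y t \<xi> + pi_4 M P V y t \<xi>"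

end

theory Submission
  imports Defs "HOL-Real_Asymp.Real_Asymp"
begin

text \<open>
  The pricing kernel \<open>\<xi>\<close> enters every formula only through powers \<open>\<xi> powr q\<close> and through values of the
  normal distribution function or density at \<open>\<plusminus>\<infinity>\<close> or at points \<open>ln \<xi> / Sig M t + b\<close>. Two facts make
  this so. The derivative of a SAHARA function at \<open>x\<close> is \<open>(z + w) powr (- \<alpha>)\<close> with \<open>z = x - d\<close> and
  \<open>w = sqrt (\<beta>\<^sup>2 + z\<^sup>2)\<close>, which is positive, so by
  continuity the one-sided slopes of \<open>V\<close> at the interior nodes are finite and positive
  (\<open>psahara_slope_left_pos\<close>, \<open>psahara_slope_right_pos\<close>). The market price of risk \<open>theta\<close> does not
  vanish on the horizon, so \<open>Sig M t > 0\<close> (\<open>accumulated_market_price_of_risk_pos\<close>).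
  
  Normal tails and the normal density decay faster than every exponential. Hence, as \<open>\<xi>\<close> tends to \<open>0\<close>
  or to \<open>\<infinity>\<close>, the increments \<open>\<Delta>\<^sub>k\<Phi>'\<close> decay faster than every power of \<open>\<xi>\<close> for all \<open>k\<close>, and so do
  the increments \<open>\<Delta>\<^sub>k\<Phi>\<close> for all \<open>k\<close> except one index \<open>j\<close>, for which the increment tends to \<open>1\<close>
  (\<open>Delta_Phi'_negligible\<close>, \<open>Delta_Phi_negligible\<close>, \<open>Delta_Phi_lead\<close>): \<open>j\<close> is the last index for
  \<open>\<xi> \<rightarrow> 0\<close> and the first one for \<open>\<xi> \<rightarrow> \<infinity>\<close>. Therefore everything but the leading part
  \<open>A = X_Rk + X_Rbark\<close>, \<open>k = j\<close>, stays bounded. Of its two summands one tends to \<open>0\<close>; the other is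
  asymptotic to a constant times a power of \<open>\<xi>\<close> and tends to \<open>\<infinity>\<close> (\<open>X_Rk\<close>, small \<open>\<xi>\<close>) or to \<open>-\<infinity>\<close>
  (\<open>X_Rbark\<close>, large \<open>\<xi>\<close>).
  
  The portfolio is a scalar multiple of \<open>eta M t\<close>. Its scalar factor is asymptotic to
  \<open>sqrt (A\<^sup>2 + b) / \<alpha>\<^sub>j\<close> with bounded \<open>b\<close>, hence to \<open>\<bar>A\<bar> / \<alpha>\<^sub>j\<close>, while the wealth is asymptotic to
  \<open>A\<close>. The ratio of the two is \<open>1 / \<alpha>\<^sub>j\<close> times the sign of \<open>A\<close>
  (\<open>coef_over_risky_tendsto\<close>, \<open>X_opt_over_risky_tendsto\<close>). The values of the deterministic factors
  built from the integrals of the rate play no role.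
\<close>

section \<open>The standard normal distribution\<close>

lemma cdf_std_normal_has_real_derivative:
  "(cdf std_normal_distribution has_real_derivative std_normal_density x) (at x)"
proof -
  interpret real_distribution std_normal_distribution
    by (rule real_dist_normal_dist)
  let ?I = "\<lambda>u. integral {x - 1..u} std_normal_density"
  have cont: "continuous_on {x - 1..x + 1} std_normal_density"
    unfolding normal_density_def by (intro continuous_intros) auto
  have "(?I has_real_derivative std_normal_density x) (at x within {x - 1..x + 1})"
    by (rule integral_has_real_derivative[OF cont]) auto
  then have "((\<lambda>u. cdf std_normal_distribution (x - 1) + ?I u) has_real_derivative
      0 + std_normal_density x) (at x)"
    by (intro DERIV_add DERIV_const) (simp add: at_within_Icc_at)
  moreover have "cdf std_normal_distribution (x - 1) + ?I u = cdf std_normal_distribution u"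
    if u: "u \<in> {x - 1<..<x + 1}" for u
  proof -
    have int: "set_integrable lborel {x - 1..u} std_normal_density"
      unfolding set_integrable_def
      by (intro integrable_mult_indicator) auto
    have "cdf std_normal_distribution u - cdf std_normal_distribution (x - 1)
        = measure std_normal_distribution {x - 1<..u}"
      using u by (intro cdf_diff_eq) auto
    also have "\<dots> = (LBINT v:{x - 1<..u}. std_normal_density v)"
      unfolding set_lebesgue_integral_def
      by (subst integral_eq_nn_integral)
        (auto simp: measure_def emeasure_density ennreal_indicator[symmetric] mult.commute
          ennreal_mult' intro!: arg_cong[where f=enn2real] nn_integral_cong)
    also have "\<dots> = (LBINT v:{x - 1..u}. std_normal_density v)"
      unfolding set_lebesgue_integral_def
      by (rule integral_cong_AE)
        (auto intro!: AE_I[where N="{x - 1}"] simp: indicator_def split: if_splits)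
    also have "\<dots> = ?I u"
      using int by (rule set_borel_integral_eq_integral)
    finally show ?thesis by simp
  qed
  ultimately show ?thesis
    by (auto intro: has_field_derivative_transform_within_open[where S="{x - 1<..<x + 1}"])
qed

text \<open>
  Completing the square; \<open>c\<close> may have either sign.
\<close>

lemma std_normal_density_le_exp:
  "std_normal_density x \<le> exp (c\<^sup>2 / 2) * exp (- c * x)"
proof -
  have "0 \<le> (x - c)\<^sup>2" by simp
  then have "- x\<^sup>2 / 2 \<le> c\<^sup>2 / 2 + (- c * x)"
    by (simp add: power2_diff algebra_simps)
  then have "exp (- x\<^sup>2 / 2) \<le> exp (c\<^sup>2 / 2) * exp (- c * x)"
    by (simp add: exp_add[symmetric])
  moreover have "1 \<le> sqrt (2 * pi)"
    using pi_ge_two by simp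
  ultimately show ?thesis
    unfolding std_normal_density_def
    by (smt (verit) divide_le_eq_1 exp_gt_zero mult_left_le_one_le divide_nonneg_nonneg)
qed

text \<open>
  For every rate \<open>c > 0\<close> the upper tail is at most a constant times \<open>exp (- c * x)\<close>: the density is dominated by
  \<open>exp (c\<^sup>2 / 2) * exp (- c * x)\<close>, so the tail minus the bound is
  nondecreasing, and it vanishes at infinity.
\<close>

lemma cdf_std_normal_upper_tail:
  assumes c: "0 < c"
  shows "1 - cdf std_normal_distribution x \<le> exp (c\<^sup>2 / 2) / c * exp (- c * x)"
proof -
  interpret real_distribution std_normal_distribution
    by (rule real_dist_normal_dist)
  let ?h = "\<lambda>x. 1 - cdf std_normal_distribution x - exp (c\<^sup>2 / 2) / c * exp (- c * x)"
  have deriv: "(?h has_real_derivative exp (c\<^sup>2 / 2) * exp (- c * u) - std_normal_density u) (at u)" for u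
    using c by (auto intro!: derivative_eq_intros cdf_std_normal_has_real_derivative)
  have "?h x \<le> ?h u" if "x \<le> u" for u
  proof (rule DERIV_nonneg_imp_nondecreasing[OF that])
    fix v show "\<exists>D. (?h has_real_derivative D) (at v) \<and> 0 \<le> D"
      using deriv[of v] std_normal_density_le_exp[of v c] by (intro exI conjI) auto
  qed
  then have "\<forall>\<^sub>F u in at_top. ?h x \<le> ?h u"
    unfolding eventually_at_top_linorder by blast
  moreover have "(?h \<longlongrightarrow> 1 - 1 - exp (c\<^sup>2 / 2) / c * 0) at_top"
  proof (intro tendsto_intros cdf_lim_at_top_prob)
    show "((\<lambda>x. exp (- c * x)) \<longlongrightarrow> 0) at_top" using c by real_asymp
  qed
  ultimately have "?h x \<le> 1 - 1 - exp (c\<^sup>2 / 2) / c * 0"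
    by (intro tendsto_lowerbound) auto
  then show ?thesis by simp
qed

lemma cdf_std_normal_lower_tail:
  assumes c: "0 < c"
  shows "cdf std_normal_distribution x \<le> exp (c\<^sup>2 / 2) / c * exp (c * x)"
proof -
  interpret real_distribution std_normal_distribution
    by (rule real_dist_normal_dist)
  let ?h = "\<lambda>x. exp (c\<^sup>2 / 2) / c * exp (c * x) - cdf std_normal_distribution x"
  have deriv: "(?h has_real_derivative exp (c\<^sup>2 / 2) * exp (c * u) - std_normal_density u) (at u)" for u
    using c by (auto intro!: derivative_eq_intros cdf_std_normal_has_real_derivative)
  have "?h u \<le> ?h x" if "u \<le> x" for u
  proof (rule DERIV_nonneg_imp_nondecreasing[OF that])
    fix v show "\<exists>D. (?h has_real_derivative D) (at v) \<and> 0 \<le> D"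
      using deriv[of v] std_normal_density_le_exp[of v "- c"] by (intro exI conjI) auto
  qed
  then have "\<forall>\<^sub>F u in at_bot. ?h u \<le> ?h x"
    unfolding eventually_at_bot_linorder by blast
  moreover have "(?h \<longlongrightarrow> exp (c\<^sup>2 / 2) / c * 0 - 0) at_bot"
  proof (intro tendsto_intros cdf_lim_at_bot)
    show "((\<lambda>x. exp (c * x)) \<longlongrightarrow> 0) at_bot" using c by real_asymp
  qed
  ultimately have "exp (c\<^sup>2 / 2) / c * 0 - 0 \<le> ?h x"
    by (intro tendsto_upperbound) auto
  then show ?thesis by simp
qed

section \<open>Functions smaller than every power\<close>

text \<open>
  \<open>f\<close> is negligible if it vanishes along \<open>F\<close> faster than every power \<open>\<xi> powr q\<close>, positive or
  negative. It is used for \<open>F = at_right 0\<close> and \<open>F = at_top\<close>, where \<open>\<xi>\<close> is eventually positive.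
\<close>

definition negligible_at :: "real filter \<Rightarrow> (real \<Rightarrow> real) \<Rightarrow> bool" where
  "negligible_at F f \<longleftrightarrow> (\<forall>q. ((\<lambda>\<xi>. \<xi> powr q * f \<xi>) \<longlongrightarrow> 0) F)"

lemma negligible_atD: "negligible_at F f \<Longrightarrow> ((\<lambda>\<xi>. \<xi> powr q * f \<xi>) \<longlongrightarrow> 0) F"
  by (simp add: negligible_at_def)

lemma negligible_at_zero [simp]: "negligible_at F (\<lambda>\<xi>. 0)"
  by (simp add: negligible_at_def)

lemma negligible_at_diff:
  assumes "negligible_at F f" "negligible_at F h"
  shows "negligible_at F (\<lambda>\<xi>. f \<xi> - h \<xi>)"
  unfolding negligible_at_def
proof
  fix q
  show "((\<lambda>\<xi>. \<xi> powr q * (f \<xi> - h \<xi>)) \<longlongrightarrow> 0) F"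
    using tendsto_diff[OF negligible_atD[OF assms(1), of q] negligible_atD[OF assms(2), of q]]
    by (simp add: algebra_simps)
qed

lemma negligible_at_tendsto:
  assumes "negligible_at F f" "\<forall>\<^sub>F \<xi> in F. 0 < \<xi>"
  shows "(f \<longlongrightarrow> 0) F"
proof -
  have "((\<lambda>\<xi>. \<xi> powr 0 * f \<xi>) \<longlongrightarrow> 0) F"
    using assms(1) by (rule negligible_atD)
  moreover have "\<forall>\<^sub>F \<xi> in F. \<xi> powr 0 * f \<xi> = f \<xi>"
    using assms(2) by eventually_elim simp
  ultimately show ?thesis
    by (rule Lim_transform_eventually)
qed

lemma negligible_at_cong:
  assumes "\<forall>\<^sub>F \<xi> in F. f \<xi> = h \<xi>"
  shows "negligible_at F f \<longleftrightarrow> negligible_at F h"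
  unfolding negligible_at_def
  using assms by (intro iff_allI tendsto_cong) (auto elim: eventually_mono)

lemma negligible_at_right_0I:
  assumes "\<And>p. 0 < p \<Longrightarrow> \<exists>C. \<forall>\<xi>>0. \<bar>f \<xi>\<bar> \<le> C * \<xi> powr p"
  shows "negligible_at (at_right 0) f"
  unfolding negligible_at_def
proof
  fix q :: real
  have "0 < 1 + \<bar>q\<bar>" by simp
  then obtain C where C: "\<forall>\<xi>>0. \<bar>f \<xi>\<bar> \<le> C * \<xi> powr (1 + \<bar>q\<bar>)"
    using assms by blast
  have "((\<lambda>\<xi>::real. C * \<xi> powr (q + (1 + \<bar>q\<bar>))) \<longlongrightarrow> C * 0) (at_right 0)"
  proof (intro tendsto_mult tendsto_const)
    have "((\<lambda>\<xi>::real. \<xi> powr r) \<longlongrightarrow> 0) (at_right 0)" if "0 < r" for r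
      using that by real_asymp
    moreover have "0 < q + (1 + \<bar>q\<bar>)" by linarith
    ultimately show "((\<lambda>\<xi>::real. \<xi> powr (q + (1 + \<bar>q\<bar>))) \<longlongrightarrow> 0) (at_right 0)" by blast
  qed
  moreover have "\<forall>\<^sub>F \<xi> in at_right 0. norm (\<xi> powr q * f \<xi>) \<le> C * \<xi> powr (q + (1 + \<bar>q\<bar>))"
    using eventually_at_right_less[of 0]
  proof eventually_elim
    case (elim \<xi>)
    have "\<xi> powr q * \<bar>f \<xi>\<bar> \<le> \<xi> powr q * (C * \<xi> powr (1 + \<bar>q\<bar>))"
      using C[rule_format, OF elim] by (rule mult_left_mono) simp
    then show ?case by (simp add: abs_mult powr_add mult.left_commute)
  qed
  ultimately show "((\<lambda>\<xi>. \<xi> powr q * f \<xi>) \<longlongrightarrow> 0) (at_right 0)"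
    unfolding mult_zero_right by (rule Lim_null_comparison[rotated])
qed

lemma negligible_at_topI:
  assumes "\<And>p. 0 < p \<Longrightarrow> \<exists>C. \<forall>\<xi>>0. \<bar>f \<xi>\<bar> \<le> C * \<xi> powr - p"
  shows "negligible_at at_top f"
  unfolding negligible_at_def
proof
  fix q :: real
  have "0 < 1 + \<bar>q\<bar>" by simp
  then obtain C where C: "\<forall>\<xi>>0. \<bar>f \<xi>\<bar> \<le> C * \<xi> powr - (1 + \<bar>q\<bar>)"
    using assms by blast
  have "((\<lambda>\<xi>::real. C * \<xi> powr (q + - (1 + \<bar>q\<bar>))) \<longlongrightarrow> C * 0) at_top"
  proof (intro tendsto_mult tendsto_const)
    have "q + - (1 + \<bar>q\<bar>) < 0" by linarith
    then show "((\<lambda>\<xi>::real. \<xi> powr (q + - (1 + \<bar>q\<bar>))) \<longlongrightarrow> 0) at_top"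
      by (rule tendsto_neg_powr) (rule filterlim_ident)
  qed
  moreover have "\<forall>\<^sub>F \<xi> in at_top. norm (\<xi> powr q * f \<xi>) \<le> C * \<xi> powr (q + - (1 + \<bar>q\<bar>))"
    using eventually_gt_at_top[of 0]
  proof eventually_elim
    case (elim \<xi>)
    have "\<xi> powr q * \<bar>f \<xi>\<bar> \<le> \<xi> powr q * (C * \<xi> powr - (1 + \<bar>q\<bar>))"
      using C[rule_format, OF elim] by (rule mult_left_mono) simp
    then show ?case by (simp add: abs_mult powr_add[symmetric] mult.left_commute)
  qed
  ultimately show "((\<lambda>\<xi>. \<xi> powr q * f \<xi>) \<longlongrightarrow> 0) at_top"
    unfolding mult_zero_right by (rule Lim_null_comparison[rotated])
qed

lemma exp_affine_ln:
  assumes "0 < \<xi>" "0 < (a::real)"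
  shows "exp (p / a * (a * ln \<xi> + b)) = exp (p / a * b) * \<xi> powr p"
proof -
  have "p / a * (a * ln \<xi> + b) = p / a * b + p * ln \<xi>"
    using assms by (simp add: field_simps)
  then show ?thesis using assms by (simp add: powr_def exp_add)
qed

text \<open>
  The exponential tail bounds of arbitrary rate become power bounds of arbitrary exponent after the
  substitution \<open>x = a * ln \<xi> + b\<close>.
\<close>

lemma cdf_std_normal_ln_negligible_at_right:
  assumes a: "0 < a"
  shows "negligible_at (at_right 0) (\<lambda>\<xi>. cdf std_normal_distribution (a * ln \<xi> + b))"
proof (rule negligible_at_right_0I, intro exI allI impI)
  interpret real_distribution std_normal_distribution
    by (rule real_dist_normal_dist)
  fix p \<xi> :: real assume p: "0 < p" and \<xi>: "0 < \<xi>"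
  show "\<bar>cdf std_normal_distribution (a * ln \<xi> + b)\<bar>
      \<le> (exp ((p / a)\<^sup>2 / 2) / (p / a) * exp (p / a * b)) * \<xi> powr p"
    using cdf_std_normal_lower_tail[of "p / a" "a * ln \<xi> + b"] exp_affine_ln[OF \<xi> a, of p b] p a
      cdf_nonneg[of "a * ln \<xi> + b"]
    by (simp add: mult.assoc)
qed

lemma cdf_std_normal_ln_negligible_at_top:
  assumes a: "0 < a"
  shows "negligible_at at_top (\<lambda>\<xi>. 1 - cdf std_normal_distribution (a * ln \<xi> + b))"
proof (rule negligible_at_topI, intro exI allI impI)
  interpret real_distribution std_normal_distribution
    by (rule real_dist_normal_dist)
  fix p \<xi> :: real assume p: "0 < p" and \<xi>: "0 < \<xi>"
  show "\<bar>1 - cdf std_normal_distribution (a * ln \<xi> + b)\<bar>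
      \<le> (exp ((p / a)\<^sup>2 / 2) / (p / a) * exp (- p / a * b)) * \<xi> powr - p"
    using cdf_std_normal_upper_tail[of "p / a" "a * ln \<xi> + b"] exp_affine_ln[OF \<xi> a, of "- p" b] p a
      cdf_bounded_prob[of "a * ln \<xi> + b"]
    by (simp add: mult.assoc)
qed

lemma std_normal_density_ln_negligible:
  assumes a: "0 < a" and F: "F = at_right 0 \<or> F = at_top"
  shows "negligible_at F (\<lambda>\<xi>. std_normal_density (a * ln \<xi> + b))"
proof -
  have bound: "\<bar>std_normal_density (a * ln \<xi> + b)\<bar>
      \<le> (exp ((p / a)\<^sup>2 / 2) * exp (p / a * b)) * \<xi> powr p" if \<xi>: "0 < \<xi>" for p \<xi>
    using std_normal_density_le_exp[of "a * ln \<xi> + b" "- p / a"] exp_affine_ln[OF \<xi> a, of p b]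
    by (simp add: mult.assoc)
  from F show ?thesis
  proof
    assume "F = at_right 0"
    then show ?thesis using bound
      by (auto intro!: negligible_at_right_0I simp del: abs_of_nonneg normal_density_nonneg; blast)
  next
    assume "F = at_top"
    then show ?thesis using bound
      by (auto intro!: negligible_at_topI simp del: abs_of_nonneg normal_density_nonneg; blast)
  qed
qed

section \<open>Two auxiliary estimates\<close>

text \<open>
  Totalised division makes this true for \<open>D = 0\<close> as well; no sign or non-vanishing of
  \<open>\<Delta>\<^sub>k\<Phi>\<close> is then needed for the terms of \<open>pi_2\<close>.
\<close>

lemma abs_mult_quotient_le: "\<bar>x * D * (D' / D)\<bar> \<le> \<bar>x * D'\<bar>" for x D D' :: real
  by (cases "D = 0") (simp_all add: abs_mult)

lemma sqrt_square_plus_bounded_ratio: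
  fixes A b :: "real \<Rightarrow> real"
  assumes A: "filterlim (\<lambda>\<xi>. \<bar>A \<xi>\<bar>) at_top F" and b: "(b \<longlongrightarrow> l) F"
  shows "((\<lambda>\<xi>. sqrt ((A \<xi>)\<^sup>2 + b \<xi>) / \<bar>A \<xi>\<bar>) \<longlongrightarrow> 1) F"
proof -
  have "filterlim (\<lambda>\<xi>. (A \<xi>)\<^sup>2) at_top F"
    using filterlim_pow_at_top[OF _ A, of 2] by simp
  then have "((\<lambda>\<xi>. sqrt (1 + b \<xi> / (A \<xi>)\<^sup>2)) \<longlongrightarrow> sqrt (1 + 0)) F"
    by (intro tendsto_intros real_tendsto_divide_at_top[OF b])
  then have "((\<lambda>\<xi>. sqrt (1 + b \<xi> / (A \<xi>)\<^sup>2)) \<longlongrightarrow> 1) F" by simp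
  moreover have "\<forall>\<^sub>F \<xi> in F. sqrt (1 + b \<xi> / (A \<xi>)\<^sup>2) = sqrt ((A \<xi>)\<^sup>2 + b \<xi>) / \<bar>A \<xi>\<bar>"
    using filterlim_at_top_dense[THEN iffD1, OF A, rule_format, of 0]
  proof eventually_elim
    case (elim \<xi>)
    then have "sqrt (1 + b \<xi> / (A \<xi>)\<^sup>2) = sqrt (((A \<xi>)\<^sup>2 + b \<xi>) / (A \<xi>)\<^sup>2)"
      by (simp add: add_divide_distrib)
    then show ?case by (simp add: real_sqrt_divide)
  qed
  ultimately show ?thesis by (rule Lim_transform_eventually)
qed

section \<open>One-sided slopes of a PSAHARA function\<close>

lemma sahara_has_real_derivative:
  assumes "0 \<le> \<alpha>" "0 < \<beta>"
  shows "(sahara \<alpha> \<beta> d has_real_derivative (x - d + sqrt (\<beta>\<^sup>2 + (x - d)\<^sup>2)) powr (- \<alpha>)) (at x)"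
    and "0 < (x - d + sqrt (\<beta>\<^sup>2 + (x - d)\<^sup>2)) powr (- \<alpha>)"
proof -
  define z where "z = x - d"
  define w where "w = sqrt (\<beta>\<^sup>2 + z\<^sup>2)"
  have "\<bar>z\<bar> < w"
    unfolding w_def using assms by (intro real_less_rsqrt) simp
  then have w: "0 < w" "0 < z + w" by linarith+
  then show "0 < (x - d + sqrt (\<beta>\<^sup>2 + (x - d)\<^sup>2)) powr (- \<alpha>)"
    by (simp add: z_def w_def)
  have w2: "w\<^sup>2 = \<beta>\<^sup>2 + z\<^sup>2" by (simp add: w_def)
  have dw: "((\<lambda>x. sqrt (\<beta>\<^sup>2 + (x - d)\<^sup>2)) has_real_derivative z / w) (at x)"
    using w unfolding w_def z_def
    by (auto intro!: derivative_eq_intros simp: divide_simps)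
  have dz: "((\<lambda>x. x - d + sqrt (\<beta>\<^sup>2 + (x - d)\<^sup>2)) has_real_derivative 1 + z / w) (at x)"
    using DERIV_add[OF DERIV_diff[OF DERIV_ident DERIV_const] dw] by simp
  show "(sahara \<alpha> \<beta> d has_real_derivative (x - d + sqrt (\<beta>\<^sup>2 + (x - d)\<^sup>2)) powr (- \<alpha>)) (at x)"
  proof (cases "\<alpha> = 1")
    case True
    have "((\<lambda>x. ln (x - d + sqrt (\<beta>\<^sup>2 + (x - d)\<^sup>2)) / 2
          + (x - d) * (sqrt (\<beta>\<^sup>2 + (x - d)\<^sup>2) - (x - d)) / (2 * \<beta>\<^sup>2)) has_real_derivative
        (1 + z / w) / (z + w) / 2 + (w - z + z * (z / w - 1)) / (2 * \<beta>\<^sup>2)) (at x)"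
    proof (intro DERIV_add DERIV_cdivide)
      show "((\<lambda>x. ln (x - d + sqrt (\<beta>\<^sup>2 + (x - d)\<^sup>2))) has_real_derivative (1 + z / w) / (z + w)) (at x)"
        using DERIV_chain2[OF _ dz, of ln "1 / (z + w)"] DERIV_ln_divide[OF w(2)]
        by (simp add: z_def w_def)
      show "((\<lambda>x. (x - d) * (sqrt (\<beta>\<^sup>2 + (x - d)\<^sup>2) - (x - d))) has_real_derivative
          w - z + z * (z / w - 1)) (at x)"
        using DERIV_mult[OF DERIV_diff[OF DERIV_ident DERIV_const[of d]]
            DERIV_diff[OF dw DERIV_diff[OF DERIV_ident DERIV_const[of d]]]]
        by (simp add: z_def[symmetric] w_def[symmetric] algebra_simps)
    qed
    moreover have "(1 + z / w) / (z + w) / 2 + (w - z + z * (z / w - 1)) / (2 * \<beta>\<^sup>2) = 1 / (z + w)"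
    proof -
      have \<beta>: "\<beta>\<^sup>2 = (w - z) * (w + z)" using w2 by (simp add: algebra_simps power2_eq_square)
      then have "w - z \<noteq> 0" using assms by auto
      then show ?thesis unfolding \<beta> using w
        by (simp add: divide_simps) (simp add: algebra_simps)
    qed
    ultimately show ?thesis
      using True w unfolding sahara_def Let_def
      by (simp add: powr_minus_divide z_def w_def)
  next
    case False
    then have \<alpha>: "\<alpha>\<^sup>2 - 1 \<noteq> 0" using assms by (auto simp: power2_eq_1_iff)
    have "((\<lambda>x. - (1 / (\<alpha>\<^sup>2 - 1)) * (x - d + sqrt (\<beta>\<^sup>2 + (x - d)\<^sup>2)) powr (- \<alpha>)
          * (x - d + \<alpha> * sqrt (\<beta>\<^sup>2 + (x - d)\<^sup>2))) has_real_derivative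
        (- (1 / (\<alpha>\<^sup>2 - 1)) * (x - d + sqrt (\<beta>\<^sup>2 + (x - d)\<^sup>2)) powr (- \<alpha>)) * (1 + \<alpha> * (z / w))
          + - (1 / (\<alpha>\<^sup>2 - 1)) * (- \<alpha> * (z + w) powr (- \<alpha> - 1) * (1 + z / w))
            * (x - d + \<alpha> * sqrt (\<beta>\<^sup>2 + (x - d)\<^sup>2))) (at x)"
    proof (intro DERIV_mult' DERIV_cmult)
      show "((\<lambda>x. (x - d + sqrt (\<beta>\<^sup>2 + (x - d)\<^sup>2)) powr - \<alpha>) has_real_derivative
          - \<alpha> * (z + w) powr (- \<alpha> - 1) * (1 + z / w)) (at x)"
      proof (rule DERIV_chain2[OF _ dz])
        show "((\<lambda>u. u powr - \<alpha>) has_real_derivative - \<alpha> * (z + w) powr (- \<alpha> - 1))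
            (at (x - d + sqrt (\<beta>\<^sup>2 + (x - d)\<^sup>2)))"
          using has_real_derivative_powr[OF w(2), of "- \<alpha>"] by (simp only: z_def w_def)
      qed
      show "((\<lambda>x. x - d + \<alpha> * sqrt (\<beta>\<^sup>2 + (x - d)\<^sup>2)) has_real_derivative 1 + \<alpha> * (z / w)) (at x)"
        using DERIV_add[OF DERIV_diff[OF DERIV_ident DERIV_const] DERIV_cmult[OF dw]] by simp
    qed
    moreover have "- (1 / (\<alpha>\<^sup>2 - 1)) * (z + w) powr (- \<alpha>) * (1 + \<alpha> * (z / w))
          + - (1 / (\<alpha>\<^sup>2 - 1)) * (- \<alpha> * (z + w) powr (- \<alpha> - 1) * (1 + z / w)) * (z + \<alpha> * w) = (z + w) powr (- \<alpha>)"
      (is "?l = ?r")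
    proof -
      have 1: "(z + w) powr (- \<alpha> - 1) = (z + w) powr (- \<alpha>) / (z + w)"
        using w by (simp add: powr_diff)
      have 2: "1 + z / w = (z + w) / w" using w by (simp add: field_simps)
      have 3: "(z + w) powr (- \<alpha> - 1) * (1 + z / w) = (z + w) powr (- \<alpha>) / w"
        unfolding 1 2 using w by simp
      have l: "- c * p * u + - c * (- \<alpha> * r * e) * v = c * (\<alpha> * (r * e) * v - p * u)"
        for c p r e u v :: real by (simp add: algebra_simps)
      have r: "c * (\<alpha> * (p / w) * v - p * u) = p * (c * (\<alpha> / w * v - u))"
        for c p u v :: real by (simp add: algebra_simps)
      have "?l = ?r * ((1 / (\<alpha>\<^sup>2 - 1)) * (\<alpha> / w * (z + \<alpha> * w) - (1 + \<alpha> * (z / w))))"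
        unfolding l 3 r ..
      also have "(1 / (\<alpha>\<^sup>2 - 1)) * (\<alpha> / w * (z + \<alpha> * w) - (1 + \<alpha> * (z / w))) = 1"
        using \<alpha> w by (simp add: field_simps power2_eq_square)
      finally show ?thesis by simp
    qed
    ultimately show ?thesis
      using False unfolding sahara_def Let_def
      by (simp only: z_def[symmetric] w_def[symmetric] if_False)
  qed
qed

text \<open>
  \<open>V\<close> and \<open>f\<close> agree on one side of \<open>a\<close> only; continuity makes them agree at \<open>a\<close>.
\<close>

lemma one_sided_derivative_eq:
  fixes V f :: "real \<Rightarrow> real"
  assumes V: "isCont V a" and f: "(f has_real_derivative D) (at a)"
    and eq: "\<forall>\<^sub>F x in at a within S. V x = f x" and nt: "at a within S \<noteq> bot"
  shows "vector_derivative V (at a within S) = D"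
proof -
  have "(f \<longlongrightarrow> V a) (at a within S)"
    by (rule Lim_transform_eventually[OF _ eq])
      (use V in \<open>auto simp: isCont_def intro: tendsto_within_subset\<close>)
  moreover have "(f \<longlongrightarrow> f a) (at a within S)"
    using DERIV_isCont[OF f] by (auto simp: isCont_def intro: tendsto_within_subset)
  ultimately have Va: "V a = f a" using nt tendsto_unique by blast
  have "((\<lambda>x. (f x - f a) / (x - a)) \<longlongrightarrow> D) (at a within S)"
    using has_field_derivative_at_within[OF f] by (simp add: has_field_derivative_iff)
  moreover have "\<forall>\<^sub>F x in at a within S. (f x - f a) / (x - a) = (V x - V a) / (x - a)"
    using eq by eventually_elim (simp add: Va)
  ultimately have "((\<lambda>x. (V x - V a) / (x - a)) \<longlongrightarrow> D) (at a within S)"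
    by (rule Lim_transform_eventually)
  then have "(V has_real_derivative D) (at a within S)"
    by (simp add: has_field_derivative_iff)
  then show ?thesis
    using nt by (intro vector_derivative_within) (auto simp: has_real_derivative_iff_has_vector_derivative)
qed

lemma psahara_node_real:
  assumes "is_psahara P V" "1 \<le> k" "k \<le> pieces P"
  obtains a where "node P k = ereal a" "node P (k - 1) < ereal a" "ereal a < node P (Suc k)"
proof -
  have *: "\<forall>i\<le>pieces P. node P i < node P (Suc i)" using assms by (simp add: is_psahara_def)
  have "node P (k - 1) < node P k" using *[rule_format, of "k - 1"] assms by simp
  moreover have "node P k < node P (Suc k)" using * assms by simp
  ultimately show ?thesis using that by (cases "node P k") auto
qed

text \<open>
  Needed for \<open>S\<close> an open half-line ending at the node \<open>a\<close>, on the side of the \<open>j\<close>-th piece; the values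
  of \<open>V\<close> elsewhere do not matter.
\<close>

lemma psahara_one_sided_slope_pos:
  assumes P: "is_psahara P V" and j: "j \<le> pieces P"
    and eq: "\<forall>\<^sub>F x in at a within S. node P j < ereal x \<and> ereal x < node P (Suc j)"
    and nt: "at a within S \<noteq> bot"
  shows "0 < vector_derivative V (at a within S)"
proof -
  let ?f = "\<lambda>x. scale P j * sahara (alpha P j) (beta P j) (shift P j) x + offset P j"
  let ?D = "(a - shift P j + sqrt ((beta P j)\<^sup>2 + (a - shift P j)\<^sup>2)) powr (- alpha P j)"
  have par: "0 \<le> alpha P j" "0 < beta P j" "0 < scale P j" and V: "continuous_on UNIV V"
    and Vj: "\<And>x. node P j < ereal x \<Longrightarrow> ereal x < node P (Suc j) \<Longrightarrow> V x = ?f x"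
    using P j by (simp_all add: is_psahara_def)
  have "(?f has_real_derivative scale P j * ?D) (at a)"
    using par by (auto intro!: derivative_eq_intros sahara_has_real_derivative)
  moreover have "\<forall>\<^sub>F x in at a within S. V x = ?f x"
    using eq by eventually_elim (simp add: Vj)
  ultimately have "vector_derivative V (at a within S) = scale P j * ?D"
    using V nt by (intro one_sided_derivative_eq) (simp_all add: continuous_on_eq_continuous_at)
  then show ?thesis using par sahara_has_real_derivative(2)[of "alpha P j" "beta P j" a "shift P j"] by simp
qed

lemma psahara_slope_right_pos:
  assumes P: "is_psahara P V" and k: "1 \<le> k" "k \<le> pieces P"
  shows "\<exists>r>0. slope_right P V k = ereal r"
proof -
  obtain a where a: "node P k = ereal a" "ereal a < node P (Suc k)"
    using psahara_node_real[OF P k] by metis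
  obtain b where b: "a < b" "ereal b < node P (Suc k)"
    using ereal_dense2[OF a(2)] by auto
  have "\<forall>\<^sub>F x in at_right a. node P k < ereal x \<and> ereal x < node P (Suc k)"
    unfolding eventually_at_right[OF b(1)]
    using b a by (intro exI[of _ b]) (auto intro: less_trans[of _ "ereal b"])
  then have "0 < vector_derivative V (at_right a)"
    using P k by (intro psahara_one_sided_slope_pos[of P V k]) auto
  then show ?thesis using k a by (simp add: slope_right_def)
qed

lemma psahara_slope_left_pos:
  assumes P: "is_psahara P V" and k: "1 \<le> k" "k \<le> pieces P"
  shows "\<exists>r>0. slope_left P V k = ereal r"
proof -
  obtain a where a: "node P k = ereal a" "node P (k - 1) < ereal a"
    using psahara_node_real[OF P k] by metis
  obtain b where b: "b < a" "node P (k - 1) < ereal b"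
    using ereal_dense2[OF a(2)] by auto
  have "\<forall>\<^sub>F x in at_left a. node P (k - 1) < ereal x \<and> ereal x < node P (Suc (k - 1))"
    unfolding eventually_at_left[OF b(1)]
    using b a k by (intro exI[of _ b]) (auto intro: less_trans[of _ "ereal b"])
  then have "0 < vector_derivative V (at_left a)"
    using P k by (intro psahara_one_sided_slope_pos[of P V "k - 1"]) auto
  then show ?thesis using k a by (simp add: slope_left_def)
qed

section \<open>Positive accumulated risk premium\<close>

text \<open>
  Since \<open>vol M s *v theta M s = excess M s\<close>, a vanishing \<open>theta M s\<close> would contradict the positive
  excess returns.
\<close>

lemma theta_nonzero:
  fixes M :: "('m::finite, 'q::finite) market"
  assumes M: "admissible_market M" and s: "s \<in> {0..horizon M}"
  shows "theta M s \<noteq> 0"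
proof
  assume 0: "theta M s = 0"
  have pd: "positive_definite (cov M s)" and gt: "\<And>i. rate M s < returns M s $ i"
    using M s by (simp_all add: admissible_market_def)
  have "x = 0" if "cov M s *v x = 0" for x
    using pd that by (auto simp: positive_definite_def)
  then have "invertible (cov M s)"
    by (auto simp: invertible_left_inverse matrix_left_invertible_ker)
  then have "cov M s ** matrix_inv (cov M s) = mat 1"
    unfolding matrix_inv_def invertible_def by (rule someI2_ex) auto
  then have "excess M s = vol M s *v theta M s"
    by (simp add: theta_def cov_def matrix_vector_mul_assoc matrix_mul_assoc)
  then have "excess M s = 0" using 0 by simp
  moreover have "0 < excess M s $ undefined"
    using gt[of undefined] by (simp add: excess_def)
  ultimately show False by simp
qed

lemma accumulated_market_price_of_risk_pos:
  assumes M: "admissible_market M" and t: "0 \<le> t" "t < horizon M"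
  shows "0 < Sig M t"
proof -
  let ?f = "\<lambda>s. indicator {t..horizon M} s *\<^sub>R (norm (theta M s))\<^sup>2"
  have "set_integrable lborel {t..horizon M} (\<lambda>s. (norm (theta M s))\<^sup>2)"
  proof (rule set_integrable_subset)
    show "set_integrable lborel {0..horizon M} (\<lambda>s. (norm (theta M s))\<^sup>2)"
      using M by (simp only: admissible_market_def)
  qed (use t in auto)
  then have int: "integrable lborel ?f" by (simp add: set_integrable_def)
  have "integral\<^sup>L lborel ?f \<noteq> 0"
  proof
    assume "integral\<^sup>L lborel ?f = 0"
    then have "AE s in lborel. ?f s = 0"
      using integral_nonneg_eq_0_iff_AE[OF int] by simp
    moreover have "?f s \<noteq> 0" if "s \<in> {t..horizon M}" for s
      using that theta_nonzero[OF M, of s] t by simp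
    ultimately have "AE s in lborel. s \<notin> {t..horizon M}"
      by (auto elim!: eventually_mono)
    then have "emeasure lborel {t..horizon M} = 0"
      by (subst (asm) AE_iff_measurable[of "{t..horizon M}"]) auto
    then show False using t by simp
  qed
  moreover have "0 \<le> integral\<^sup>L lborel ?f" by (rule Bochner_Integration.integral_nonneg) simp
  ultimately have "0 < integral\<^sup>L lborel ?f" by (rule le_neq_trans[OF _ not_sym, rotated])
  then show ?thesis by (simp add: Sig_def set_lebesgue_integral_def)
qed

section \<open>The normal terms as functions of the pricing kernel\<close>

lemma Phi'_ereal: "\<Phi>' (ereal x) = std_normal_density x"
  using DERIV_imp_deriv[OF cdf_std_normal_has_real_derivative] by (simp add: \<Phi>'_def)

text \<open>
  The common form of \<open>g0\<close>, \<open>g1\<close> and \<open>g2\<close>: \<open>g0\<close> plus a constant, which does not move \<open>\<plusminus>\<infinity>\<close>.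
\<close>

definition shifted_g0 :: "('m::finite, 'q::finite) market \<Rightarrow> real \<Rightarrow> real \<Rightarrow> ereal \<Rightarrow> ereal" where
  "shifted_g0 M t c z = g0 M t z + ereal c"

lemma g0_eq_shifted: "g0 M t = shifted_g0 M t 0"
  by (rule ext) (simp add: shifted_g0_def zero_ereal_def[symmetric])

lemma g1_eq_shifted: "g1 M P t k = shifted_g0 M t (- (1 / alpha P k * Sig M t))"
  by (rule ext) (simp add: shifted_g0_def g1_def minus_ereal_def)

lemma g2_eq_shifted: "g2 M P t k = shifted_g0 M t (1 / alpha P k * Sig M t)"
  by (rule ext) (simp add: shifted_g0_def g2_def)

text \<open>
  At a finite positive slope \<open>r\<close> the argument of the normal distribution function is affine in
  \<open>ln \<xi>\<close> with leading coefficient \<open>1 / Sig M t\<close>.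
\<close>

lemma shifted_g0_pos:
  assumes "0 < r" "0 < y"
  obtains b where "\<And>\<xi>. 0 < \<xi> \<Longrightarrow>
    shifted_g0 M t c (ereal r / ereal (y * \<xi>)) = ereal (1 / Sig M t * ln \<xi> + b)"
proof
  fix \<xi> :: real assume \<xi>: "0 < \<xi>"
  let ?I = "LBINT s:{t..horizon M}. rate M s - (norm (theta M s))\<^sup>2 / 2"
  have z: "0 < r / (y * \<xi>)" "ereal r / ereal (y * \<xi>) = ereal (r / (y * \<xi>))"
    using assms \<xi> by simp_all
  have ln: "ln (r / (y * \<xi>)) = ln r - ln y - ln \<xi>"
    using assms \<xi> by (simp add: ln_div ln_mult)
  have "g0 M t (ereal (r / (y * \<xi>))) = ereal (- (1 / Sig M t) * (ln (r / (y * \<xi>)) + ?I))"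
    using z(1) by (simp add: g0_def)
  then show "shifted_g0 M t c (ereal r / ereal (y * \<xi>))
      = ereal (1 / Sig M t * ln \<xi> + (- (1 / Sig M t) * (ln r - ln y + ?I) + c))"
    unfolding shifted_g0_def z(2) ln by (simp add: diff_divide_distrib add_divide_distrib)
qed

lemma shifted_g0_infinity:
  assumes "0 < x"
  shows "shifted_g0 M t c (\<infinity> / ereal x) = - \<infinity>"
  using assms by (simp add: shifted_g0_def g0_def divide_ereal_def)

lemma shifted_g0_zero: "shifted_g0 M t c (0 / ereal x) = \<infinity>"
  by (simp add: shifted_g0_def g0_def)

lemma Phi_shifted_g0_pos:
  assumes S: "0 < Sig M t" and ry: "0 < r" "0 < y"
  shows "negligible_at (at_right 0) (\<lambda>\<xi>. \<Phi> (shifted_g0 M t c (ereal r / ereal (y * \<xi>))))"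
    and "negligible_at at_top (\<lambda>\<xi>. 1 - \<Phi> (shifted_g0 M t c (ereal r / ereal (y * \<xi>))))"
    and "F = at_right 0 \<or> F = at_top \<Longrightarrow>
      negligible_at F (\<lambda>\<xi>. \<Phi>' (shifted_g0 M t c (ereal r / ereal (y * \<xi>))))"
proof -
  obtain b where b: "\<And>\<xi>. 0 < \<xi> \<Longrightarrow>
      shifted_g0 M t c (ereal r / ereal (y * \<xi>)) = ereal (1 / Sig M t * ln \<xi> + b)"
    using shifted_g0_pos[OF ry] by metis
  have a: "0 < 1 / Sig M t" using S by simp
  have ev: "\<forall>\<^sub>F \<xi> in F. G (shifted_g0 M t c (ereal r / ereal (y * \<xi>))) = G (ereal (1 / Sig M t * ln \<xi> + b))"
    if "F = at_right 0 \<or> F = at_top" for F and G :: "ereal \<Rightarrow> real"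
  proof -
    have "\<forall>\<^sub>F \<xi> in F. 0 < \<xi>"
      using that by (auto intro: eventually_at_right_less eventually_gt_at_top)
    then show ?thesis by eventually_elim (simp only: b)
  qed
  show "negligible_at (at_right 0) (\<lambda>\<xi>. \<Phi> (shifted_g0 M t c (ereal r / ereal (y * \<xi>))))"
    using cdf_std_normal_ln_negligible_at_right[OF a]
    by (subst negligible_at_cong[OF ev]) (simp_all add: \<Phi>_def)
  show "negligible_at at_top (\<lambda>\<xi>. 1 - \<Phi> (shifted_g0 M t c (ereal r / ereal (y * \<xi>))))"
    using cdf_std_normal_ln_negligible_at_top[OF a]
    by (subst negligible_at_cong[OF ev[where G = "\<lambda>z. 1 - \<Phi> z"]]) (simp_all add: \<Phi>_def)
  show "negligible_at F (\<lambda>\<xi>. \<Phi>' (shifted_g0 M t c (ereal r / ereal (y * \<xi>))))"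
    if F: "F = at_right 0 \<or> F = at_top"
    using std_normal_density_ln_negligible[OF a F]
    by (subst negligible_at_cong[OF ev[OF F]]) (simp_all add: Phi'_ereal)
qed

lemma Phi_infinity [simp]: "\<Phi> \<infinity> = 1" "\<Phi> (-\<infinity>) = 0" "\<Phi>' \<infinity> = 0" "\<Phi>' (-\<infinity>) = 0"
  using \<Phi>_def[of \<infinity>] \<Phi>_def[of "-\<infinity>"] \<Phi>'_def[of \<infinity>] \<Phi>'_def[of "-\<infinity>"] by simp_all

section \<open>The two regimes\<close>

text \<open>
  Both limits are treated at once. Along \<open>F\<close> the kernel tends to \<open>0\<close> or to \<open>\<infinity>\<close>; \<open>j\<close> is the index
  of the piece that dominates there (the last piece for small, the first piece for large \<open>\<xi>\<close>), and
  \<open>\<sigma>\<close> is the sign of the wealth in that limit.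
\<close>

locale extreme_state =
  fixes M :: "('m::finite, 'q::finite) market" and P :: psahara and V :: "real \<Rightarrow> real"
    and y t :: real and F :: "real filter" and j :: nat and \<sigma> :: real
  assumes Sig_pos: "0 < Sig M t" and y_pos: "0 < y" and psahara: "is_psahara P V"
    and regime: "(F = at_right 0 \<and> j = pieces P \<and> \<sigma> = 1) \<or> (F = at_top \<and> j = 0 \<and> \<sigma> = - 1)"
    and alpha_lead: "alpha P j \<noteq> 0"
begin

lemma alpha_nonneg: "k \<le> pieces P \<Longrightarrow> 0 \<le> alpha P k"
  and beta_pos: "k \<le> pieces P \<Longrightarrow> 0 < beta P k"
  and scale_pos: "k \<le> pieces P \<Longrightarrow> 0 < scale P k"
  using psahara by (simp_all add: is_psahara_def)

lemma lead_le: "j \<le> pieces P"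
  using regime by auto

lemma F_cases: "F = at_right 0 \<or> F = at_top"
  using regime by auto

lemma eventually_pos: "\<forall>\<^sub>F \<xi> in F. 0 < \<xi>"
  using F_cases by (auto intro: eventually_at_right_less eventually_gt_at_top)

text \<open>
  \<open>G\<close> stands for \<open>\<Phi>\<close> or \<open>\<Phi>'\<close>, evaluated at the left or right slope at the \<open>k\<close>-th node.
\<close>

abbreviation normal_left :: "(ereal \<Rightarrow> real) \<Rightarrow> real \<Rightarrow> nat \<Rightarrow> real \<Rightarrow> real" where
  "normal_left G c k \<xi> \<equiv> G (shifted_g0 M t c (slope_left P V k / ereal (y * \<xi>)))"

abbreviation normal_right :: "(ereal \<Rightarrow> real) \<Rightarrow> real \<Rightarrow> nat \<Rightarrow> real \<Rightarrow> real" where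
  "normal_right G c k \<xi> \<equiv> G (shifted_g0 M t c (slope_right P V k / ereal (y * \<xi>)))"

lemma eventually_normal_right_0:
  "\<forall>\<^sub>F \<xi> in F. shifted_g0 M t c (slope_right P V 0 / ereal (y * \<xi>)) = - \<infinity>"
proof -
  have right_0: "slope_right P V 0 = \<infinity>" by (simp add: slope_right_def)
  show ?thesis
    unfolding right_0 using eventually_pos
    by eventually_elim (simp only: shifted_g0_infinity mult_pos_pos[OF y_pos])
qed

lemma normal_left_last:
  "shifted_g0 M t c (slope_left P V (Suc (pieces P)) / ereal (y * \<xi>)) = \<infinity>"
  by (simp only: slope_left_def if_True simp_thms shifted_g0_zero)

lemma normal_inner:
  assumes k: "1 \<le> k" "k \<le> pieces P"
  shows "F = at_right 0 \<Longrightarrow> negligible_at F (normal_left \<Phi> c k)"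
    and "F = at_right 0 \<Longrightarrow> negligible_at F (normal_right \<Phi> c k)"
    and "F = at_top \<Longrightarrow> negligible_at F (\<lambda>\<xi>. 1 - normal_left \<Phi> c k \<xi>)"
    and "F = at_top \<Longrightarrow> negligible_at F (\<lambda>\<xi>. 1 - normal_right \<Phi> c k \<xi>)"
    and "negligible_at F (normal_left \<Phi>' c k)"
    and "negligible_at F (normal_right \<Phi>' c k)"
proof -
  obtain r1 r2 where r: "0 < r1" "slope_left P V k = ereal r1" "0 < r2" "slope_right P V k = ereal r2"
    using psahara_slope_left_pos[OF psahara k] psahara_slope_right_pos[OF psahara k] by blast
  note 1 = Phi_shifted_g0_pos[OF Sig_pos r(1) y_pos, where c = c, folded r(2)]
  note 2 = Phi_shifted_g0_pos[OF Sig_pos r(3) y_pos, where c = c, folded r(4)]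
  show "F = at_right 0 \<Longrightarrow> negligible_at F (normal_left \<Phi> c k)"
    and "F = at_right 0 \<Longrightarrow> negligible_at F (normal_right \<Phi> c k)"
    and "F = at_top \<Longrightarrow> negligible_at F (\<lambda>\<xi>. 1 - normal_left \<Phi> c k \<xi>)"
    and "F = at_top \<Longrightarrow> negligible_at F (\<lambda>\<xi>. 1 - normal_right \<Phi> c k \<xi>)"
    using 1(1,2) 2(1,2) by auto
  show "negligible_at F (normal_left \<Phi>' c k)" "negligible_at F (normal_right \<Phi>' c k)"
    using 1(3) 2(3) F_cases by auto
qed

lemma negligible_normal_right_0:
  assumes "G (-\<infinity>) = 0"
  shows "negligible_at F (normal_right G c 0)"
proof -
  have "\<forall>\<^sub>F \<xi> in F. normal_right G c 0 \<xi> = 0"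
    using eventually_normal_right_0[of c] by eventually_elim (simp add: assms)
  then show ?thesis using negligible_at_cong by fastforce
qed

text \<open>
  For \<open>k \<noteq> j\<close> both values of \<open>\<Phi>\<close> tend to the same limit, \<open>0\<close> for small and \<open>1\<close> for large \<open>\<xi>\<close>,
  and each is negligibly close to it. The infinite slope at the node \<open>0\<close> and the zero slope at the
  node \<open>n + 1\<close> give the exact values \<open>0\<close> and \<open>1\<close>.
\<close>

lemma Delta_Phi_negligible:
  assumes k: "k \<le> pieces P" "k \<noteq> j"
  shows "negligible_at F (\<lambda>\<xi>. Delta P V y \<xi> k (\<Phi> \<circ> shifted_g0 M t c))"
  using regime
proof
  assume r: "F = at_right 0 \<and> j = pieces P \<and> \<sigma> = 1"
  have "negligible_at F (normal_left \<Phi> c (Suc k))"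
    using normal_inner(1)[of "Suc k" c] k r by auto
  moreover have "negligible_at F (normal_right \<Phi> c k)"
    using normal_inner(2)[of k c] negligible_normal_right_0[of \<Phi> c] k r by (cases "k = 0") auto
  ultimately show ?thesis
    unfolding Delta_def o_def by (rule negligible_at_diff)
next
  assume r: "F = at_top \<and> j = 0 \<and> \<sigma> = - 1"
  have "negligible_at F (\<lambda>\<xi>. 1 - normal_right \<Phi> c k \<xi>)"
    using normal_inner(4)[of k c] k r by auto
  moreover have "negligible_at F (\<lambda>\<xi>. 1 - normal_left \<Phi> c (Suc k) \<xi>)"
  proof (cases "k = pieces P")
    case True
    then show ?thesis by (simp only: normal_left_last Phi_infinity) simp
  next
    case False
    then show ?thesis using normal_inner(3)[of "Suc k" c] k r by auto
  qed
  ultimately have "negligible_at F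
      (\<lambda>\<xi>. (1 - normal_right \<Phi> c k \<xi>) - (1 - normal_left \<Phi> c (Suc k) \<xi>))"
    by (rule negligible_at_diff)
  then show ?thesis by (simp add: Delta_def o_def)
qed

text \<open>
  For \<open>k = j\<close> the two values of \<open>\<Phi>\<close> tend to \<open>1\<close> and \<open>0\<close>.
\<close>

lemma Delta_Phi_lead:
  "((\<lambda>\<xi>. Delta P V y \<xi> j (\<Phi> \<circ> shifted_g0 M t c)) \<longlongrightarrow> 1) F"
  using regime
proof
  assume r: "F = at_right 0 \<and> j = pieces P \<and> \<sigma> = 1"
  have "negligible_at F (normal_right \<Phi> c j)"
    using normal_inner(2)[of j c] negligible_normal_right_0[of \<Phi> c] r by (cases "j = 0") auto
  then have "((\<lambda>\<xi>. 1 - normal_right \<Phi> c j \<xi>) \<longlongrightarrow> 1 - 0) F"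
    by (intro tendsto_intros negligible_at_tendsto eventually_pos)
  then show ?thesis
    using r by (simp only: Delta_def o_def normal_left_last Phi_infinity) simp
next
  assume r: "F = at_top \<and> j = 0 \<and> \<sigma> = - 1"
  have "negligible_at F (\<lambda>\<xi>. 1 - normal_left \<Phi> c (Suc j) \<xi>)"
  proof (cases "j = pieces P")
    case True
    then show ?thesis by (simp only: normal_left_last Phi_infinity) simp
  next
    case False
    then show ?thesis using normal_inner(3)[of "Suc j" c] r by auto
  qed
  then have "((\<lambda>\<xi>. 1 - (1 - normal_left \<Phi> c (Suc j) \<xi>) - normal_right \<Phi> c 0 \<xi>) \<longlongrightarrow> 1 - 0 - 0) F"
    by (intro tendsto_intros negligible_at_tendsto[OF _ eventually_pos] negligible_normal_right_0) simp_all
  then show ?thesis using r by (simp add: Delta_def o_def)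
qed

lemma Delta_Phi'_negligible:
  assumes k: "k \<le> pieces P"
  shows "negligible_at F (\<lambda>\<xi>. Delta P V y \<xi> k (\<Phi>' \<circ> shifted_g0 M t c))"
  unfolding Delta_def o_def
proof (rule negligible_at_diff)
  show "negligible_at F (normal_left \<Phi>' c (Suc k))"
  proof (cases "k = pieces P")
    case True
    then show ?thesis by (simp only: normal_left_last Phi_infinity) simp
  next
    case False
    then show ?thesis using normal_inner(5)[of "Suc k" c] k by auto
  qed
  show "negligible_at F (normal_right \<Phi>' c k)"
    using normal_inner(6)[of k c] negligible_normal_right_0[of \<Phi>' c] k by (cases "k = 0") auto
qed

lemma Delta_Phi_tendsto:
  assumes "k \<le> pieces P"
  shows "((\<lambda>\<xi>. Delta P V y \<xi> k (\<Phi> \<circ> shifted_g0 M t c)) \<longlongrightarrow> of_bool (k = j)) F"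
  using Delta_Phi_lead Delta_Phi_negligible[OF assms] negligible_at_tendsto[OF _ eventually_pos]
  by (cases "k = j") auto

section \<open>Wealth components\<close>

lemma X_D_tendsto: "(X_D M P V y t \<longlongrightarrow> 0) F"
proof -
  have "((\<lambda>\<xi>. normal_right \<Phi> 0 k \<xi> - normal_left \<Phi> 0 k \<xi>) \<longlongrightarrow> 0) F"
    if k: "k \<in> {1..pieces P}" for k
    using regime
  proof
    assume "F = at_right 0 \<and> j = pieces P \<and> \<sigma> = 1"
    then have "negligible_at F (\<lambda>\<xi>. normal_right \<Phi> 0 k \<xi> - normal_left \<Phi> 0 k \<xi>)"
      using k by (intro negligible_at_diff normal_inner) auto
    then show ?thesis by (rule negligible_at_tendsto[OF _ eventually_pos])
  next
    assume "F = at_top \<and> j = 0 \<and> \<sigma> = - 1"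
    then have "negligible_at F (\<lambda>\<xi>. (1 - normal_left \<Phi> 0 k \<xi>) - (1 - normal_right \<Phi> 0 k \<xi>))"
      using k by (intro negligible_at_diff normal_inner) auto
    then show ?thesis using negligible_at_tendsto[OF _ eventually_pos] by simp
  qed
  then have "((\<lambda>\<xi>. \<Sum>k=1..pieces P. discount M t * real_of_ereal (node P k)
      * (normal_right \<Phi> 0 k \<xi> - normal_left \<Phi> 0 k \<xi>))
      \<longlongrightarrow> (\<Sum>k=1..pieces P. discount M t * real_of_ereal (node P k) * 0)) F"
    by (intro tendsto_sum tendsto_mult tendsto_const)
  then show ?thesis unfolding X_D_def[abs_def] g0_eq_shifted by simp
qed

lemma X_B_tendsto: "(X_B M P V y t \<longlongrightarrow> shift P j * discount M t) F"
proof -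
  have "((\<lambda>\<xi>. X_B M P V y t \<xi>) \<longlongrightarrow> (\<Sum>k=0..pieces P. discount M t * shift P k * of_bool (k = j)
      * of_bool (alpha P k \<noteq> 0))) F"
    unfolding X_B_def g0_eq_shifted
    by (intro tendsto_sum tendsto_mult tendsto_const Delta_Phi_tendsto) simp
  also have "(\<Sum>k=0..pieces P. discount M t * shift P k * of_bool (k = j) * of_bool (alpha P k \<noteq> 0))
      = (\<Sum>k=0..pieces P. if k = j then discount M t * shift P k else 0)"
    using alpha_lead by (intro sum.cong) auto
  also have "\<dots> = shift P j * discount M t"
    using lead_le by simp
  finally show ?thesis .
qed

lemma powr_scale:
  assumes "k \<le> pieces P" "0 < \<xi>"
  shows "(scale P k / (y * \<xi>)) powr p = (scale P k / y) powr p * \<xi> powr (- p)"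
  using assms y_pos scale_pos[of k]
  by (simp add: powr_divide powr_mult powr_minus divide_simps)

lemma negligible_times_powr_scale:
  assumes k: "k \<le> pieces P" and f: "negligible_at F f"
  shows "((\<lambda>\<xi>. (scale P k / (y * \<xi>)) powr p * f \<xi>) \<longlongrightarrow> 0) F"
proof -
  have "((\<lambda>\<xi>. (scale P k / y) powr p * (\<xi> powr (- p) * f \<xi>)) \<longlongrightarrow> (scale P k / y) powr p * 0) F"
    by (intro tendsto_intros negligible_atD f)
  then have "((\<lambda>\<xi>. (scale P k / y) powr p * (\<xi> powr (- p) * f \<xi>)) \<longlongrightarrow> 0) F" by simp
  moreover have "\<forall>\<^sub>F \<xi> in F. (scale P k / y) powr p * (\<xi> powr (- p) * f \<xi>)
      = (scale P k / (y * \<xi>)) powr p * f \<xi>"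
    using eventually_pos by eventually_elim (simp add: powr_scale[OF k])
  ultimately show ?thesis by (rule Lim_transform_eventually)
qed

lemma alpha_pos: "k \<le> pieces P \<Longrightarrow> alpha P k \<noteq> 0 \<Longrightarrow> 0 < alpha P k"
  using alpha_nonneg[of k] by simp

text \<open>
  The deterministic factors in front of the power of \<open>scale P k / (y * \<xi>)\<close> in \<open>X_Rk\<close> and \<open>X_Rbark\<close>.
\<close>

abbreviation wR :: "nat \<Rightarrow> real" where
  "wR k \<equiv> exp ((- 1 + 1 / alpha P k) *
      (LBINT s:{t..horizon M}. rate M s + 1 / (2 * alpha P k) * (norm (theta M s))\<^sup>2)) * (1 / 2)"

abbreviation wRbar :: "nat \<Rightarrow> real" where
  "wRbar k \<equiv> - (1 / 2) * (beta P k)\<^sup>2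
     * exp ((- 1 - 1 / alpha P k) *
            (LBINT s:{t..horizon M}. rate M s - 1 / (2 * alpha P k) * (norm (theta M s))\<^sup>2))"

lemma X_Rk_tendsto_0:
  assumes k: "k \<le> pieces P" "k \<noteq> j"
  shows "(X_Rk M P V y t k \<longlongrightarrow> 0) F"
proof -
  have "((\<lambda>\<xi>. wR k * ((scale P k / (y * \<xi>)) powr (1 / alpha P k)
      * Delta P V y \<xi> k (\<Phi> \<circ> g1 M P t k)) * of_bool (alpha P k \<noteq> 0))
      \<longlongrightarrow> wR k * 0 * of_bool (alpha P k \<noteq> 0)) F"
    unfolding g1_eq_shifted
    by (intro tendsto_mult tendsto_const negligible_times_powr_scale Delta_Phi_negligible k)
  then show ?thesis by (simp only: X_Rk_def[abs_def] mult.assoc mult_zero_left mult_zero_right)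
qed

lemma X_Rbark_tendsto_0:
  assumes k: "k \<le> pieces P" "k \<noteq> j"
  shows "(X_Rbark M P V y t k \<longlongrightarrow> 0) F"
proof -
  have "((\<lambda>\<xi>. wRbar k * ((scale P k / (y * \<xi>)) powr (- (1 / alpha P k))
      * Delta P V y \<xi> k (\<Phi> \<circ> g2 M P t k)) * of_bool (alpha P k \<noteq> 0))
      \<longlongrightarrow> wRbar k * 0 * of_bool (alpha P k \<noteq> 0)) F"
    unfolding g2_eq_shifted
    by (intro tendsto_mult tendsto_const negligible_times_powr_scale Delta_Phi_negligible k)
  then show ?thesis by (simp only: X_Rbark_def[abs_def] mult.assoc mult_zero_left mult_zero_right)
qed

lemma lead_powr_limits:
  assumes "0 < p"
  shows "F = at_right 0 \<Longrightarrow> filterlim (\<lambda>\<xi>. (scale P j / (y * \<xi>)) powr p) at_top F"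
    and "F = at_right 0 \<Longrightarrow> ((\<lambda>\<xi>. (scale P j / (y * \<xi>)) powr (- p)) \<longlongrightarrow> 0) F"
    and "F = at_top \<Longrightarrow> ((\<lambda>\<xi>. (scale P j / (y * \<xi>)) powr p) \<longlongrightarrow> 0) F"
    and "F = at_top \<Longrightarrow> filterlim (\<lambda>\<xi>. (scale P j / (y * \<xi>)) powr (- p)) at_top F"
  using assms y_pos scale_pos[OF lead_le] by (simp; real_asymp)+

lemma lead_limits:
  "F = at_right 0 \<Longrightarrow> filterlim (X_Rk M P V y t j) at_top F"
  "F = at_right 0 \<Longrightarrow> (X_Rbark M P V y t j \<longlongrightarrow> 0) F"
  "F = at_top \<Longrightarrow> (X_Rk M P V y t j \<longlongrightarrow> 0) F"
  "F = at_top \<Longrightarrow> filterlim (X_Rbark M P V y t j) at_bot F"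
proof -
  have p: "0 < 1 / alpha P j" using alpha_pos[OF lead_le alpha_lead] by simp
  have R: "X_Rk M P V y t j = (\<lambda>\<xi>. wR j * Delta P V y \<xi> j (\<Phi> \<circ> g1 M P t j)
      * (scale P j / (y * \<xi>)) powr (1 / alpha P j))"
    using alpha_lead by (simp add: X_Rk_def[abs_def] mult_ac)
  have Rbar: "X_Rbark M P V y t j = (\<lambda>\<xi>. wRbar j * Delta P V y \<xi> j (\<Phi> \<circ> g2 M P t j)
      * (scale P j / (y * \<xi>)) powr (- (1 / alpha P j)))"
    using alpha_lead by (simp add: X_Rbark_def[abs_def] mult_ac)
  have DR: "((\<lambda>\<xi>. wR j * Delta P V y \<xi> j (\<Phi> \<circ> g1 M P t j)) \<longlongrightarrow> wR j * 1) F"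
    unfolding g1_eq_shifted by (intro tendsto_mult tendsto_const Delta_Phi_lead)
  have DRbar: "((\<lambda>\<xi>. wRbar j * Delta P V y \<xi> j (\<Phi> \<circ> g2 M P t j)) \<longlongrightarrow> wRbar j * 1) F"
    unfolding g2_eq_shifted by (intro tendsto_mult tendsto_const Delta_Phi_lead)
  show "filterlim (X_Rk M P V y t j) at_top F" if "F = at_right 0"
    unfolding R by (rule filterlim_tendsto_pos_mult_at_top[OF DR _ lead_powr_limits(1)[OF p that]]) simp
  show "(X_Rbark M P V y t j \<longlongrightarrow> 0) F" if "F = at_right 0"
    unfolding Rbar using tendsto_mult[OF DRbar lead_powr_limits(2)[OF p that]] by simp
  show "(X_Rk M P V y t j \<longlongrightarrow> 0) F" if "F = at_top"
    unfolding R using tendsto_mult[OF DR lead_powr_limits(3)[OF p that]] by simp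
  show "filterlim (X_Rbark M P V y t j) at_bot F" if "F = at_top"
    unfolding Rbar
    by (rule filterlim_tendsto_neg_mult_at_bot[OF DRbar _ lead_powr_limits(4)[OF p that]])
      (use beta_pos[OF lead_le] in simp)
qed

lemma X_R_split: "X_R M P V y t \<xi> = X_Rk M P V y t j \<xi> + (\<Sum>k\<in>{0..pieces P} - {j}. X_Rk M P V y t k \<xi>)"
  unfolding X_R_def using lead_le by (intro sum.remove) auto

lemma X_Rbar_split:
  "X_Rbar M P V y t \<xi> = X_Rbark M P V y t j \<xi> + (\<Sum>k\<in>{0..pieces P} - {j}. X_Rbark M P V y t k \<xi>)"
  unfolding X_Rbar_def using lead_le by (intro sum.remove) auto

lemma X_R_rest_tendsto_0: "((\<lambda>\<xi>. \<Sum>k\<in>{0..pieces P} - {j}. X_Rk M P V y t k \<xi>) \<longlongrightarrow> 0) F"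
  by (intro tendsto_null_sum X_Rk_tendsto_0) auto

lemma X_Rbar_rest_tendsto_0: "((\<lambda>\<xi>. \<Sum>k\<in>{0..pieces P} - {j}. X_Rbark M P V y t k \<xi>) \<longlongrightarrow> 0) F"
  by (intro tendsto_null_sum X_Rbark_tendsto_0) auto

lemma X_R_X_Rbar_limits:
  "F = at_right 0 \<Longrightarrow> filterlim (X_R M P V y t) at_top F"
  "F = at_right 0 \<Longrightarrow> (X_Rbar M P V y t \<longlongrightarrow> 0) F"
  "F = at_top \<Longrightarrow> (X_R M P V y t \<longlongrightarrow> 0) F"
  "F = at_top \<Longrightarrow> filterlim (X_Rbar M P V y t) at_bot F"
proof -
  show "filterlim (X_R M P V y t) at_top F" if "F = at_right 0"
    unfolding X_R_split[abs_def]
    using filterlim_tendsto_add_at_top[OF X_R_rest_tendsto_0 lead_limits(1)[OF that]]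
    by (simp add: add.commute)
  show "(X_Rbar M P V y t \<longlongrightarrow> 0) F" if "F = at_right 0"
    unfolding X_Rbar_split[abs_def]
    using tendsto_add[OF lead_limits(2)[OF that] X_Rbar_rest_tendsto_0] by simp
  show "(X_R M P V y t \<longlongrightarrow> 0) F" if "F = at_top"
    unfolding X_R_split[abs_def]
    using tendsto_add[OF lead_limits(3)[OF that] X_R_rest_tendsto_0] by simp
  show "filterlim (X_Rbar M P V y t) at_bot F" if "F = at_top"
    unfolding X_Rbar_split[abs_def]
    using filterlim_tendsto_add_at_bot_iff[OF X_Rbar_rest_tendsto_0, of "X_Rbark M P V y t j"]
      lead_limits(4)[OF that]
    by (simp add: add.commute)
qed

text \<open>
  The part \<open>X_Rk + X_Rbark\<close> of the wealth generated by the \<open>k\<close>-th piece;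
  \<open>risky j\<close> is the only unbounded part.
\<close>

abbreviation risky :: "nat \<Rightarrow> real \<Rightarrow> real" where
  "risky k \<xi> \<equiv> X_Rk M P V y t k \<xi> + X_Rbark M P V y t k \<xi>"

lemma risky_tendsto_0: "k \<le> pieces P \<Longrightarrow> k \<noteq> j \<Longrightarrow> (risky k \<longlongrightarrow> 0) F"
  using tendsto_add[OF X_Rk_tendsto_0 X_Rbark_tendsto_0] by simp

lemma X_opt_minus_risky_tendsto:
  "((\<lambda>\<xi>. X_opt M P V y t \<xi> - risky j \<xi>) \<longlongrightarrow> shift P j * discount M t) F"
proof -
  have "((\<lambda>\<xi>. X_D M P V y t \<xi> + X_B M P V y t \<xi>
      + ((\<Sum>k\<in>{0..pieces P} - {j}. X_Rk M P V y t k \<xi>) + (\<Sum>k\<in>{0..pieces P} - {j}. X_Rbark M P V y t k \<xi>)))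
      \<longlongrightarrow> 0 + shift P j * discount M t + (0 + 0)) F"
    by (intro tendsto_add X_D_tendsto X_B_tendsto X_R_rest_tendsto_0 X_Rbar_rest_tendsto_0)
  then show ?thesis
    unfolding X_opt_def X_R_split X_Rbar_split by (simp add: algebra_simps)
qed

lemma risky_lead_limits:
  shows "F = at_right 0 \<Longrightarrow> filterlim (risky j) at_top F"
    and "F = at_top \<Longrightarrow> filterlim (risky j) at_bot F"
proof -
  show "filterlim (risky j) at_top F" if "F = at_right 0"
    using filterlim_tendsto_add_at_top[OF lead_limits(2)[OF that] lead_limits(1)[OF that]]
    by (simp add: add.commute)
  show "filterlim (risky j) at_bot F" if "F = at_top"
    using filterlim_tendsto_add_at_bot_iff[OF lead_limits(3)[OF that]] lead_limits(4)[OF that]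
    by blast
qed

lemma X_opt_limits:
  "F = at_right 0 \<Longrightarrow> filterlim (X_opt M P V y t) at_top F"
  "F = at_top \<Longrightarrow> filterlim (X_opt M P V y t) at_bot F"
proof -
  have eq: "X_opt M P V y t = (\<lambda>\<xi>. (X_opt M P V y t \<xi> - risky j \<xi>) + risky j \<xi>)" by simp
  show "filterlim (X_opt M P V y t) at_top F" if "F = at_right 0"
    by (subst eq, rule filterlim_tendsto_add_at_top[OF X_opt_minus_risky_tendsto risky_lead_limits(1)[OF that]])
  show "filterlim (X_opt M P V y t) at_bot F" if "F = at_top"
    by (subst eq, rule iffD2[OF filterlim_tendsto_add_at_bot_iff[OF X_opt_minus_risky_tendsto]
        risky_lead_limits(2)[OF that]])
qed

lemma risky_lead_eventually:
  "\<forall>\<^sub>F \<xi> in F. risky j \<xi> = \<sigma> * \<bar>risky j \<xi>\<bar> \<and> \<bar>risky j \<xi>\<bar> \<noteq> 0"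
  and abs_risky_lead: "filterlim (\<lambda>\<xi>. \<bar>risky j \<xi>\<bar>) at_top F"
proof -
  have "(\<forall>\<^sub>F \<xi> in F. risky j \<xi> = \<sigma> * \<bar>risky j \<xi>\<bar> \<and> \<bar>risky j \<xi>\<bar> \<noteq> 0)
      \<and> filterlim (\<lambda>\<xi>. \<bar>risky j \<xi>\<bar>) at_top F"
    using regime
  proof
    assume r: "F = at_right 0 \<and> j = pieces P \<and> \<sigma> = 1"
    then have F: "F = at_right 0" ..
    have "\<forall>\<^sub>F \<xi> in F. 0 < risky j \<xi>"
      using risky_lead_limits(1)[OF F] by (simp add: filterlim_at_top_dense)
    moreover have "filterlim (\<lambda>\<xi>. \<bar>risky j \<xi>\<bar>) at_top F"
      using filterlim_compose[OF filterlim_abs_real risky_lead_limits(1)[OF F]] .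
    ultimately show ?thesis using r by (auto elim: eventually_mono)
  next
    assume r: "F = at_top \<and> j = 0 \<and> \<sigma> = - 1"
    then have F: "F = at_top" ..
    have "\<forall>\<^sub>F \<xi> in F. risky j \<xi> < 0"
      using risky_lead_limits(2)[OF F] by (simp add: filterlim_at_bot_dense)
    moreover
    have "filterlim (\<lambda>\<xi>. \<bar>- risky j \<xi>\<bar>) at_top F"
      using filterlim_compose[OF filterlim_abs_real]
        risky_lead_limits(2)[OF F] filterlim_uminus_at_bot by blast
    then have "filterlim (\<lambda>\<xi>. \<bar>risky j \<xi>\<bar>) at_top F"
      by (simp only: abs_minus_cancel)
    ultimately show ?thesis using r by (auto elim: eventually_mono)
  qed
  then show "\<forall>\<^sub>F \<xi> in F. risky j \<xi> = \<sigma> * \<bar>risky j \<xi>\<bar> \<and> \<bar>risky j \<xi>\<bar> \<noteq> 0"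
    and "filterlim (\<lambda>\<xi>. \<bar>risky j \<xi>\<bar>) at_top F" by auto
qed

lemma X_opt_over_risky_tendsto: "((\<lambda>\<xi>. X_opt M P V y t \<xi> / \<bar>risky j \<xi>\<bar>) \<longlongrightarrow> \<sigma>) F"
proof -
  have "((\<lambda>\<xi>. (X_opt M P V y t \<xi> - risky j \<xi>) / \<bar>risky j \<xi>\<bar> + \<sigma>) \<longlongrightarrow> 0 + \<sigma>) F"
    by (intro tendsto_add tendsto_const real_tendsto_divide_at_top[OF X_opt_minus_risky_tendsto] abs_risky_lead)
  then have "((\<lambda>\<xi>. (X_opt M P V y t \<xi> - risky j \<xi>) / \<bar>risky j \<xi>\<bar> + \<sigma>) \<longlongrightarrow> \<sigma>) F"
    by simp
  moreover have "\<forall>\<^sub>F \<xi> in F. (X_opt M P V y t \<xi> - risky j \<xi>) / \<bar>risky j \<xi>\<bar> + \<sigma>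
      = X_opt M P V y t \<xi> / \<bar>risky j \<xi>\<bar>"
    using risky_lead_eventually
  proof eventually_elim
    case (elim \<xi>)
    then have "risky j \<xi> / \<bar>risky j \<xi>\<bar> = \<sigma>" by (metis nonzero_mult_div_cancel_right)
    then show ?case by (simp add: diff_divide_distrib)
  qed
  ultimately show ?thesis by (rule Lim_transform_eventually)
qed

section \<open>Portfolio components\<close>

text \<open>
  For the leading index any finite limit suffices, since \<open>(risky j)\<^sup>2\<close> is unbounded.
\<close>

lemma b_term_tendsto:
  assumes k: "k \<le> pieces P"
  shows "\<exists>l. (b_term M P V y t k \<longlongrightarrow> l) F \<and> (k \<noteq> j \<longrightarrow> l = 0)"
proof (intro exI conjI impI)
  show "(b_term M P V y t k \<longlongrightarrow> (beta P k)\<^sup>2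
     * exp (2 * (LBINT s:{t..horizon M}.
                   - rate M s + 1 / (2 * (alpha P k)\<^sup>2) * (norm (theta M s))\<^sup>2))
     * of_bool (k = j) * of_bool (k = j)) F"
    unfolding b_term_def[abs_def] g1_eq_shifted g2_eq_shifted
    by (intro tendsto_mult tendsto_const Delta_Phi_tendsto k)
qed simp

text \<open>
  Here \<open>X\<close> is \<open>X_Rk\<close> or \<open>X_Rbark\<close>. Its factor \<open>\<Delta>\<^sub>k\<Phi>\<close> absorbs the denominator, which leaves a power of
  \<open>\<xi>\<close> times the negligible \<open>\<Delta>\<^sub>k\<Phi>'\<close>.
\<close>

lemma quotient_term_tendsto_0:
  assumes k: "k \<le> pieces P"
    and X: "\<And>\<xi>. X \<xi> = w * (scale P k / (y * \<xi>)) powr p * D \<xi>"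
    and D': "negligible_at F D'"
  shows "((\<lambda>\<xi>. X \<xi> * (D' \<xi> / D \<xi>)) \<longlongrightarrow> 0) F"
proof (rule Lim_null_comparison)
  show "((\<lambda>\<xi>. \<bar>w * ((scale P k / (y * \<xi>)) powr p * D' \<xi>)\<bar>) \<longlongrightarrow> 0) F"
    by (intro tendsto_rabs_zero tendsto_mult_right_zero negligible_times_powr_scale k D')
  have "norm (X \<xi> * (D' \<xi> / D \<xi>)) \<le> \<bar>w * ((scale P k / (y * \<xi>)) powr p * D' \<xi>)\<bar>" for \<xi>
    using abs_mult_quotient_le[of "w * (scale P k / (y * \<xi>)) powr p" "D \<xi>" "D' \<xi>"]
    by (simp only: X real_norm_def mult.assoc)
  then show "\<forall>\<^sub>F \<xi> in F. norm (X \<xi> * (D' \<xi> / D \<xi>)) \<le> \<bar>w * ((scale P k / (y * \<xi>)) powr p * D' \<xi>)\<bar>"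
    by (rule always_eventually[rule_format])
qed

text \<open>
  \<open>coef_1\<close> to \<open>coef_4\<close> are the scalar factors of \<open>eta M t\<close> in \<open>pi_1\<close> to \<open>pi_4\<close>.
\<close>

abbreviation coef_1 :: "real \<Rightarrow> real" where
  "coef_1 \<xi> \<equiv> (\<Sum>k=0..pieces P. 1 / alpha P k
      * sqrt ((risky k \<xi>)\<^sup>2 + b_term M P V y t k \<xi>) * of_bool (alpha P k \<noteq> 0))"

lemma coef_1_over_risky_tendsto: "((\<lambda>\<xi>. coef_1 \<xi> / \<bar>risky j \<xi>\<bar>) \<longlongrightarrow> 1 / alpha P j) F"
proof -
  let ?s = "\<lambda>k \<xi>. sqrt ((risky k \<xi>)\<^sup>2 + b_term M P V y t k \<xi>)"
  have "((\<lambda>\<xi>. ?s k \<xi> / \<bar>risky j \<xi>\<bar>) \<longlongrightarrow> of_bool (k = j)) F" if k: "k \<le> pieces P" for k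
  proof -
    obtain l where l: "(b_term M P V y t k \<longlongrightarrow> l) F" "k \<noteq> j \<Longrightarrow> l = 0"
      using b_term_tendsto[OF k] by blast
    show ?thesis
    proof (cases "k = j")
      case True
      then show ?thesis using sqrt_square_plus_bounded_ratio[OF abs_risky_lead] l(1) by simp
    next
      case False
      have "((\<lambda>\<xi>. ?s k \<xi>) \<longlongrightarrow> sqrt (0\<^sup>2 + l)) F"
        by (intro tendsto_intros risky_tendsto_0 k False l(1))
      then show ?thesis
        using real_tendsto_divide_at_top[OF _ abs_risky_lead] False by simp
    qed
  qed
  then have "((\<lambda>\<xi>. \<Sum>k=0..pieces P. 1 / alpha P k * (?s k \<xi> / \<bar>risky j \<xi>\<bar>) * of_bool (alpha P k \<noteq> 0))
      \<longlongrightarrow> (\<Sum>k=0..pieces P. 1 / alpha P k * of_bool (k = j) * of_bool (alpha P k \<noteq> 0))) F"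
    by (intro tendsto_sum tendsto_mult tendsto_const) simp
  also have "(\<Sum>k=0..pieces P. 1 / alpha P k * of_bool (k = j) * of_bool (alpha P k \<noteq> 0))
      = (\<Sum>k=0..pieces P. if k = j then 1 / alpha P k else 0)"
    using alpha_lead by (intro sum.cong) auto
  also have "\<dots> = 1 / alpha P j" using lead_le by simp
  finally show ?thesis
    by (simp add: sum_divide_distrib)
qed

abbreviation coef_2 :: "real \<Rightarrow> real" where
  "coef_2 \<xi> \<equiv> - (1 / Sig M t) *
      (\<Sum>k=0..pieces P.
        (X_Rk M P V y t k \<xi>
           * (Delta P V y \<xi> k (\<Phi>' \<circ> g1 M P t k) / Delta P V y \<xi> k (\<Phi> \<circ> g1 M P t k))
         + X_Rbark M P V y t k \<xi>
           * (Delta P V y \<xi> k (\<Phi>' \<circ> g2 M P t k) / Delta P V y \<xi> k (\<Phi> \<circ> g2 M P t k)))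
        * of_bool (alpha P k \<noteq> 0))"

lemma coef_2_tendsto_0: "(coef_2 \<longlongrightarrow> 0) F"
proof -
  have R: "((\<lambda>\<xi>. X_Rk M P V y t k \<xi>
      * (Delta P V y \<xi> k (\<Phi>' \<circ> g1 M P t k) / Delta P V y \<xi> k (\<Phi> \<circ> g1 M P t k))) \<longlongrightarrow> 0) F"
    if k: "k \<le> pieces P" for k
  proof (rule quotient_term_tendsto_0[OF k])
    show "X_Rk M P V y t k \<xi> = wR k * of_bool (alpha P k \<noteq> 0)
        * (scale P k / (y * \<xi>)) powr (1 / alpha P k) * Delta P V y \<xi> k (\<Phi> \<circ> g1 M P t k)" for \<xi>
      by (simp only: X_Rk_def mult_ac)
    show "negligible_at F (\<lambda>\<xi>. Delta P V y \<xi> k (\<Phi>' \<circ> g1 M P t k))"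
      unfolding g1_eq_shifted using k by (rule Delta_Phi'_negligible)
  qed
  have Rbar: "((\<lambda>\<xi>. X_Rbark M P V y t k \<xi>
      * (Delta P V y \<xi> k (\<Phi>' \<circ> g2 M P t k) / Delta P V y \<xi> k (\<Phi> \<circ> g2 M P t k))) \<longlongrightarrow> 0) F"
    if k: "k \<le> pieces P" for k
  proof (rule quotient_term_tendsto_0[OF k])
    show "X_Rbark M P V y t k \<xi> = wRbar k * of_bool (alpha P k \<noteq> 0)
        * (scale P k / (y * \<xi>)) powr (- (1 / alpha P k)) * Delta P V y \<xi> k (\<Phi> \<circ> g2 M P t k)" for \<xi>
      by (simp only: X_Rbark_def mult_ac)
    show "negligible_at F (\<lambda>\<xi>. Delta P V y \<xi> k (\<Phi>' \<circ> g2 M P t k))"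
      unfolding g2_eq_shifted using k by (rule Delta_Phi'_negligible)
  qed
  show ?thesis
    by (intro tendsto_mult_right_zero tendsto_null_sum tendsto_mult_left_zero tendsto_add_zero R Rbar) auto
qed

abbreviation coef_3 :: "real \<Rightarrow> real" where
  "coef_3 \<xi> \<equiv> - (1 / Sig M t) * discount M t *
      (\<Sum>k=1..pieces P. real_of_ereal (node P k) *
         (\<Phi>' (g0 M t (slope_right P V k / ereal (y * \<xi>)))
          - \<Phi>' (g0 M t (slope_left P V k / ereal (y * \<xi>)))))"

lemma coef_3_tendsto_0: "(coef_3 \<longlongrightarrow> 0) F"
  unfolding g0_eq_shifted
  by (intro tendsto_mult_right_zero tendsto_null_sum negligible_at_tendsto[OF _ eventually_pos]
      negligible_at_diff normal_inner(5,6)) auto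

abbreviation coef_4 :: "real \<Rightarrow> real" where
  "coef_4 \<xi> \<equiv> - (1 / Sig M t) * discount M t *
      (\<Sum>k=0..pieces P. shift P k * Delta P V y \<xi> k (\<Phi>' \<circ> g0 M t))"

lemma coef_4_tendsto_0: "(coef_4 \<longlongrightarrow> 0) F"
  unfolding g0_eq_shifted
  by (intro tendsto_mult_right_zero tendsto_null_sum negligible_at_tendsto[OF _ eventually_pos]
      Delta_Phi'_negligible) auto

lemma pi_tendsto_0: "(pi_2 M P V y t \<longlongrightarrow> 0) F" "(pi_3 M P V y t \<longlongrightarrow> 0) F" "(pi_4 M P V y t \<longlongrightarrow> 0) F"
  using tendsto_scaleR[OF coef_2_tendsto_0 tendsto_const[of "eta M t"]]
    tendsto_scaleR[OF coef_3_tendsto_0 tendsto_const[of "eta M t"]]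
    tendsto_scaleR[OF coef_4_tendsto_0 tendsto_const[of "eta M t"]]
  unfolding pi_2_def[abs_def] pi_3_def[abs_def] pi_4_def[abs_def] scaleR_zero_left .

text \<open>
  The scalar factor of \<open>eta M t\<close> in \<open>pi_opt\<close>.
\<close>

abbreviation coef :: "real \<Rightarrow> real" where
  "coef \<xi> \<equiv> coef_1 \<xi> + (coef_2 \<xi> + coef_3 \<xi> + coef_4 \<xi>)"

lemma pi_opt_eq_coef: "pi_opt M P V y t \<xi> = coef \<xi> *\<^sub>R eta M t"
  by (simp only: pi_opt_def pi_1_def pi_2_def pi_3_def pi_4_def scaleR_add_left add.assoc)

lemma coef_over_risky_tendsto: "((\<lambda>\<xi>. coef \<xi> / \<bar>risky j \<xi>\<bar>) \<longlongrightarrow> 1 / alpha P j) F"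
proof -
  have "((\<lambda>\<xi>. coef_2 \<xi> + coef_3 \<xi> + coef_4 \<xi>) \<longlongrightarrow> 0) F"
    by (intro tendsto_add_zero coef_2_tendsto_0 coef_3_tendsto_0 coef_4_tendsto_0)
  then have "((\<lambda>\<xi>. (coef_2 \<xi> + coef_3 \<xi> + coef_4 \<xi>) / \<bar>risky j \<xi>\<bar>) \<longlongrightarrow> 0) F"
    by (rule real_tendsto_divide_at_top[OF _ abs_risky_lead])
  from tendsto_add[OF coef_1_over_risky_tendsto this] show ?thesis
    unfolding add_divide_distrib[symmetric] add_0_right .
qed

lemma coef_at_top: "filterlim coef at_top F"
proof -
  have cancel: "r \<noteq> 0 \<Longrightarrow> c / r * r = c" for c r :: real by simp
  have "filterlim (\<lambda>\<xi>. coef \<xi> / \<bar>risky j \<xi>\<bar> * \<bar>risky j \<xi>\<bar>) at_top F"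
    using alpha_pos[OF lead_le alpha_lead]
    by (intro filterlim_tendsto_pos_mult_at_top[OF coef_over_risky_tendsto _ abs_risky_lead]) simp
  moreover have "\<forall>\<^sub>F \<xi> in F. coef \<xi> / \<bar>risky j \<xi>\<bar> * \<bar>risky j \<xi>\<bar> = coef \<xi>"
    using risky_lead_eventually
  proof eventually_elim
    case (elim \<xi>)
    then have "\<bar>risky j \<xi>\<bar> \<noteq> 0" by blast
    then show ?case by (rule cancel)
  qed
  ultimately show ?thesis
    using filterlim_cong[OF refl refl] by fast
qed

lemma pi_opt_component_at_top:
  assumes "0 < eta M t $ i"
  shows "filterlim (\<lambda>\<xi>. pi_opt M P V y t \<xi> $ i) at_top F"
  unfolding pi_opt_eq_coef vector_scaleR_component real_scaleR_def
  by (rule filterlim_at_top_mult_tendsto_pos[OF tendsto_const assms coef_at_top])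

lemma pi_opt_over_X_opt_tendsto:
  "((\<lambda>\<xi>. pi_opt M P V y t \<xi> /\<^sub>R X_opt M P V y t \<xi>)
     \<longlongrightarrow> (\<sigma> * (1 / alpha P j)) *\<^sub>R (matrix_inv (cov M t) *v excess M t)) F"
proof -
  have "((\<lambda>\<xi>. (coef \<xi> / \<bar>risky j \<xi>\<bar>) / (X_opt M P V y t \<xi> / \<bar>risky j \<xi>\<bar>))
      \<longlongrightarrow> (1 / alpha P j) / \<sigma>) F"
    by (intro tendsto_divide coef_over_risky_tendsto X_opt_over_risky_tendsto) (use regime in auto)
  moreover have "\<forall>\<^sub>F \<xi> in F. (coef \<xi> / \<bar>risky j \<xi>\<bar>) / (X_opt M P V y t \<xi> / \<bar>risky j \<xi>\<bar>)
      = inverse (X_opt M P V y t \<xi>) * coef \<xi>"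
    using risky_lead_eventually by eventually_elim (simp only: divide_inverse, simp)
  ultimately have "((\<lambda>\<xi>. inverse (X_opt M P V y t \<xi>) * coef \<xi>) \<longlongrightarrow> (1 / alpha P j) / \<sigma>) F"
    by (rule Lim_transform_eventually)
  then have "((\<lambda>\<xi>. (inverse (X_opt M P V y t \<xi>) * coef \<xi>) *\<^sub>R eta M t)
      \<longlongrightarrow> ((1 / alpha P j) / \<sigma>) *\<^sub>R eta M t) F"
    by (intro tendsto_scaleR tendsto_const)
  moreover have "(1 / alpha P j) / \<sigma> = \<sigma> * (1 / alpha P j)"
    using regime by auto
  ultimately show ?thesis
    by (simp only: pi_opt_eq_coef scaleR_scaleR eta_def)
qed

end

theorem theorem3:
  fixes M :: "('m::finite, 'q::finite) market"
    and P :: psahara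
    and U V :: "real \<Rightarrow> real"
    and t y :: real
  assumes market: "admissible_market M"
    and utility: "mono U"
    and envelope: "is_concave_envelope U V"
    and psahara: "is_psahara P V"
    and alphas: "alpha P 0 \<noteq> 0" "alpha P (pieces P) \<noteq> 0"
    and t: "0 \<le> t" "t < horizon M"
    and y: "0 < y"
  shows
    "(filterlim (X_opt M P V y t) at_top (at_right 0) \<and>
      ((\<lambda>\<xi>. pi_opt M P V y t \<xi> /\<^sub>R X_opt M P V y t \<xi>)
         \<longlongrightarrow> (1 / alpha P (pieces P)) *\<^sub>R (matrix_inv (cov M t) *v excess M t)) (at_right 0) \<and>
      filterlim (X_R M P V y t) at_top (at_right 0) \<and>
      (X_Rbar M P V y t \<longlongrightarrow> 0) (at_right 0) \<and>
      (X_B M P V y t \<longlongrightarrow> shift P (pieces P) * discount M t) (at_right 0) \<and>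
      (X_D M P V y t \<longlongrightarrow> 0) (at_right 0) \<and>
      (\<forall>i. 0 < eta M t $ i \<longrightarrow> filterlim (\<lambda>\<xi>. pi_opt M P V y t \<xi> $ i) at_top (at_right 0)) \<and>
      (pi_2 M P V y t \<longlongrightarrow> 0) (at_right 0) \<and>
      (pi_3 M P V y t \<longlongrightarrow> 0) (at_right 0) \<and>
      (pi_4 M P V y t \<longlongrightarrow> 0) (at_right 0))
     \<and>
     (filterlim (X_opt M P V y t) at_bot at_top \<and>
      ((\<lambda>\<xi>. pi_opt M P V y t \<xi> /\<^sub>R X_opt M P V y t \<xi>)
         \<longlongrightarrow> - (1 / alpha P 0) *\<^sub>R (matrix_inv (cov M t) *v excess M t)) at_top \<and>
      (X_R M P V y t \<longlongrightarrow> 0) at_top \<and>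
      filterlim (X_Rbar M P V y t) at_bot at_top \<and>
      (X_B M P V y t \<longlongrightarrow> shift P 0 * discount M t) at_top \<and>
      (X_D M P V y t \<longlongrightarrow> 0) at_top \<and>
      (\<forall>i. 0 < eta M t $ i \<longrightarrow> filterlim (\<lambda>\<xi>. pi_opt M P V y t \<xi> $ i) at_top at_top) \<and>
      (pi_2 M P V y t \<longlongrightarrow> 0) at_top \<and>
      (pi_3 M P V y t \<longlongrightarrow> 0) at_top \<and>
      (pi_4 M P V y t \<longlongrightarrow> 0) at_top)"
proof -
  have Sig: "0 < Sig M t" using market t by (rule accumulated_market_price_of_risk_pos)
  interpret small: extreme_state M P V y t "at_right 0" "pieces P" 1
    using Sig y psahara alphas
    by unfold_locales auto
  interpret large: extreme_state M P V y t at_top 0 "- 1"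
    using Sig y psahara alphas
    by unfold_locales auto
  show ?thesis
    using small.X_opt_limits(1) small.pi_opt_over_X_opt_tendsto small.X_R_X_Rbar_limits(1,2)
      small.X_B_tendsto small.X_D_tendsto small.pi_opt_component_at_top small.pi_tendsto_0
      large.X_opt_limits(2) large.pi_opt_over_X_opt_tendsto large.X_R_X_Rbar_limits(3,4)
      large.X_B_tendsto large.X_D_tendsto large.pi_opt_component_at_top large.pi_tendsto_0
    unfolding mult_1_left mult_minus1 by blast
qed

end
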